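(* Let $\omega>0$, $\nu\ge0$, $\epsilon>0$ with $\omega^2+\nu^2+\epsilon^2=1$, and let $q$ be the quadratic form on $\mathbb R^4$ $$q(x_1,x_2,\xi_1,\xi_2)=\xi_1^2+\xi_2^2+(1-\nu^2)x_1^2+(1+\nu^2)x_2^2-2\omega(x_1\xi_2-x_2\xi_1).$$ With $\mu_1,\mu_2,\lambda_1,\lambda_2,c,d$ as in the context, define the symplectic mapping $\chi:(y,\eta)\mapsto(x,\xi)$ by the matrix $$\chi=\begin{pmatrix}\lambda_1&0&0&-\frac{\lambda_1}d\\0&\lambda_2&-\frac{\lambda_2}d&0\\0&\frac d{\lambda_1}-\lambda_2cd&c\lambda_2&0\\\frac d{\lambda_2}-\lambda_1cd&0&0&c\lambda_1\end{pmatrix}$$ and the metaplectic mapping $M$ by $$(Mv)(x_1,x_2)=(\lambda_1\lambda_2)^{-1/2}e^{2i\pi d\left((\lambda_1\lambda_2)^{-1}-c\right)x_1x_2}\bigl(e^{2i\pi d^{-1}D_1D_2}v\bigr)(\lambda_1^{-1}x_1,\lambda_2^{-1}x_2).$$ Then $$(q\circ\chi)(y,\eta)=\mu_1^2y_1^2+\mu_2^2y_2^2+\eta_1^2+\eta_2^2,\qquad (q\circ\chi)^w=M^*q^wM.$$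
   Context: Notation: $\alpha=\sqrt{\nu^4+4\omega^2}$, $\mu_1^2=1+\omega^2-\alpha$, $\mu_2^2=1+\omega^2+\alpha$ ($\mu_j>0$), $\gamma=2\alpha/\omega$, $\lambda_1^2=\frac{\alpha-2\omega^2+\nu^2}{2\alpha}$, $\lambda_2^2=\frac{\alpha+2\omega^2+\nu^2}{2\alpha}$ ($\lambda_j>0$), $d=\frac{\gamma\lambda_1\lambda_2}2$, $c=\frac{\lambda_1^2+\lambda_2^2}{2\lambda_1\lambda_2}$. $D_j=\frac1{2i\pi}\partial_{x_j}$; the Fourier transform is $\hat u(\xi)=\int e^{-2i\pi x\cdot\xi}u(x)dx$, and $e^{2i\pi d^{-1}D_1D_2}$ is the Fourier multiplier by $e^{2i\pi d^{-1}\eta_1\eta_2}$. Vectors in $\mathbb R^4$ are ordered as $(x_1,x_2,\xi_1,\xi_2)$, $(y_1,y_2,\eta_1,\eta_2)$. For a symbol $a$ on $\mathbb R^2_x\times\mathbb R^2_\xi$, the Weyl quantization is $$(a^wu)(x)=\iint e^{2i\pi(x-x')\cdot\xi}a\bigl(\tfrac{x+x'}2,\xi\bigr)u(x')\,dx'd\xi .$$ For the polynomial symbols here, operators act on $\mathscr S(\mathbb R^2)$. $M$ is a unitary operator of $L^2(\mathbb R^2)$ and an automorphism of $\mathscr S(\mathbb R^2)$; $M^*$ is its adjoint. *)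

theory Defs
  imports "HOL-Analysis.Analysis"
begin

type_synonym plane = "real \<times> real"

definition partial_deriv :: "'a::euclidean_space \<Rightarrow> ('a \<Rightarrow> complex) \<Rightarrow> 'a \<Rightarrow> complex" where
  "partial_deriv b f x = frechet_derivative f (at x) b"

(* Schwartz space: every iterated partial derivative (along a list of basis vectors) exists, is
   itself differentiable, and decays faster than any power of the norm. *)
definition schwartz :: "('a::euclidean_space \<Rightarrow> complex) set" where
  "schwartz = {f. \<forall>bs. set bs \<subseteq> Basis \<longrightarrow>
     (\<forall>x. foldr partial_deriv bs f differentiable at x) \<and>
     (\<forall>k::nat. bounded (range (\<lambda>x. norm x ^ k *\<^sub>R foldr partial_deriv bs f x)))}"

definition l2_inner :: "('a::euclidean_space \<Rightarrow> complex) \<Rightarrow> ('a \<Rightarrow> complex) \<Rightarrow> complex" where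
  "l2_inner u v = (\<integral>x. u x * cnj (v x) \<partial>lborel)"

(* L2-adjoint of an operator T acting on Schwartz functions: adjoint_op T v is the Schwartz
   function w (unique if it exists) with <T u, v> = <u, w> for all Schwartz u. *)
definition adjoint_op ::
    "(('a::euclidean_space \<Rightarrow> complex) \<Rightarrow> ('a \<Rightarrow> complex)) \<Rightarrow> ('a \<Rightarrow> complex) \<Rightarrow> ('a \<Rightarrow> complex)" where
  "adjoint_op T v = (THE w. w \<in> schwartz \<and> (\<forall>u\<in>schwartz. l2_inner (T u) v = l2_inner u w))"

(* An isometric bijection of the Schwartz space; by density it extends to a unitary operator of L2. *)
definition unitary_on_schwartz ::
    "(('a::euclidean_space \<Rightarrow> complex) \<Rightarrow> ('a \<Rightarrow> complex)) \<Rightarrow> bool" where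
  "unitary_on_schwartz T \<longleftrightarrow> bij_betw T schwartz schwartz \<and>
     (\<forall>u\<in>schwartz. \<forall>v\<in>schwartz. l2_inner (T u) (T v) = l2_inner u v)"

definition fourier :: "('a::euclidean_space \<Rightarrow> complex) \<Rightarrow> 'a \<Rightarrow> complex" where
  "fourier u \<xi> = (\<integral>x. exp (- 2 * \<i> * pi * (x \<bullet> \<xi>)) * u x \<partial>lborel)"

definition fourier_multiplier ::
    "('a::euclidean_space \<Rightarrow> complex) \<Rightarrow> ('a \<Rightarrow> complex) \<Rightarrow> 'a \<Rightarrow> complex" where
  "fourier_multiplier m u x = (\<integral>\<eta>. exp (2 * \<i> * pi * (x \<bullet> \<eta>)) * (m \<eta> * fourier u \<eta>) \<partial>lborel)"

definition phase_point :: "plane \<Rightarrow> plane \<Rightarrow> real^4" where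
  "phase_point x \<xi> = vector [fst x, snd x, fst \<xi>, snd \<xi>]"

(* Iterated integral, first over x' and then over \<xi>; for a polynomial symbol and a Schwartz function
   each of the two integrals converges absolutely, while the double integral need not. *)
definition weyl :: "(real^4 \<Rightarrow> complex) \<Rightarrow> (plane \<Rightarrow> complex) \<Rightarrow> plane \<Rightarrow> complex" where
  "weyl a u x = (\<integral>\<xi>. (\<integral>x'. exp (2 * \<i> * pi * ((x - x') \<bullet> \<xi>)) *
       a (phase_point ((1 / 2) *\<^sub>R (x + x')) \<xi>) * u x' \<partial>lborel) \<partial>lborel)"

definition symplectic_form :: "real^4 \<Rightarrow> real^4 \<Rightarrow> real" where
  "symplectic_form z w = z$3 * w$1 + z$4 * w$2 - (w$3 * z$1 + w$4 * z$2)"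

definition symplectic_matrix :: "real^4^4 \<Rightarrow> bool" where
  "symplectic_matrix A \<longleftrightarrow> (\<forall>z w. symplectic_form (A *v z) (A *v w) = symplectic_form z w)"

definition alpha :: "real \<Rightarrow> real \<Rightarrow> real" where
  "alpha \<omega> \<nu> = sqrt (\<nu>^4 + 4 * \<omega>^2)"

definition mu1 :: "real \<Rightarrow> real \<Rightarrow> real" where
  "mu1 \<omega> \<nu> = sqrt (1 + \<omega>^2 - alpha \<omega> \<nu>)"

definition mu2 :: "real \<Rightarrow> real \<Rightarrow> real" where
  "mu2 \<omega> \<nu> = sqrt (1 + \<omega>^2 + alpha \<omega> \<nu>)"

definition gam :: "real \<Rightarrow> real \<Rightarrow> real" where
  "gam \<omega> \<nu> = 2 * alpha \<omega> \<nu> / \<omega>"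

definition lam1 :: "real \<Rightarrow> real \<Rightarrow> real" where
  "lam1 \<omega> \<nu> = sqrt ((alpha \<omega> \<nu> - 2 * \<omega>^2 + \<nu>^2) / (2 * alpha \<omega> \<nu>))"

definition lam2 :: "real \<Rightarrow> real \<Rightarrow> real" where
  "lam2 \<omega> \<nu> = sqrt ((alpha \<omega> \<nu> + 2 * \<omega>^2 + \<nu>^2) / (2 * alpha \<omega> \<nu>))"

definition dpar :: "real \<Rightarrow> real \<Rightarrow> real" where
  "dpar \<omega> \<nu> = gam \<omega> \<nu> * lam1 \<omega> \<nu> * lam2 \<omega> \<nu> / 2"

definition cpar :: "real \<Rightarrow> real \<Rightarrow> real" where
  "cpar \<omega> \<nu> = ((lam1 \<omega> \<nu>)^2 + (lam2 \<omega> \<nu>)^2) / (2 * lam1 \<omega> \<nu> * lam2 \<omega> \<nu>)"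

definition qform :: "real \<Rightarrow> real \<Rightarrow> real^4 \<Rightarrow> real" where
  "qform \<omega> \<nu> z = (z$3)^2 + (z$4)^2 + (1 - \<nu>^2) * (z$1)^2 + (1 + \<nu>^2) * (z$2)^2
     - 2 * \<omega> * (z$1 * z$4 - z$2 * z$3)"

definition chi_matrix :: "real \<Rightarrow> real \<Rightarrow> real^4^4" where
  "chi_matrix \<omega> \<nu> = (let l1 = lam1 \<omega> \<nu>; l2 = lam2 \<omega> \<nu>; c = cpar \<omega> \<nu>; d = dpar \<omega> \<nu> in
     vector [vector [l1, 0, 0, - (l1 / d)],
             vector [0, l2, - (l2 / d), 0],
             vector [0, d / l1 - l2 * c * d, c * l2, 0],
             vector [d / l2 - l1 * c * d, 0, 0, c * l1]])"

definition chi :: "real \<Rightarrow> real \<Rightarrow> real^4 \<Rightarrow> real^4" where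
  "chi \<omega> \<nu> z = chi_matrix \<omega> \<nu> *v z"

definition metap :: "real \<Rightarrow> real \<Rightarrow> (plane \<Rightarrow> complex) \<Rightarrow> plane \<Rightarrow> complex" where
  "metap \<omega> \<nu> v = (\<lambda>(x1, x2).
     let l1 = lam1 \<omega> \<nu>; l2 = lam2 \<omega> \<nu>; c = cpar \<omega> \<nu>; d = dpar \<omega> \<nu> in
     of_real ((l1 * l2) powr (- 1 / 2)) *
     exp (2 * \<i> * pi * (d * (1 / (l1 * l2) - c) * x1 * x2)) *
     fourier_multiplier (\<lambda>\<eta>. exp (2 * \<i> * pi * (fst \<eta> * snd \<eta> / d))) v (x1 / l1, x2 / l2))"

(* The radicands are positive, so mu1, mu2, lam1, lam2 are the positive square roots. *)
lemma parameters_positive: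
  fixes \<omega> \<nu> \<epsilon> :: real
  assumes "\<omega> > 0" "\<nu> \<ge> 0" "\<epsilon> > 0" "\<omega>^2 + \<nu>^2 + \<epsilon>^2 = 1"
  shows "alpha \<omega> \<nu> > 0" "mu1 \<omega> \<nu> > 0" "mu2 \<omega> \<nu> > 0" "lam1 \<omega> \<nu> > 0" "lam2 \<omega> \<nu> > 0"
proof -
  let ?a = "alpha \<omega> \<nu>"
  have w: "\<omega>^2 > 0" using assms by simp
  have e: "\<epsilon>^2 > 0" using assms by simp
  have n4: "\<nu>^4 = (\<nu>^2)^2" by simp
  have n0: "\<nu>^2 \<ge> 0" by simp
  have a2: "?a^2 = \<nu>^4 + 4 * \<omega>^2" unfolding alpha_def by simp
  have "\<nu>^4 + 4 * \<omega>^2 > 0" using w by (simp add: add_nonneg_pos)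
  then show a: "?a > 0" unfolding alpha_def by simp
  have "\<nu>^2 < 1 - \<omega>^2" using e assms(4) by linarith
  then have "(\<nu>^2)^2 < (1 - \<omega>^2)^2" using n0 by (intro power_strict_mono) simp_all
  then have "?a^2 < (1 + \<omega>^2)^2" using a2 n4 by (simp add: power2_eq_square algebra_simps)
  then have "?a < 1 + \<omega>^2" using w by (meson add_nonneg_nonneg less_imp_le power_less_imp_less_base zero_le_one)
  then show "mu1 \<omega> \<nu> > 0" unfolding mu1_def by simp
  have "1 + \<omega>^2 + ?a > 0" using a w by linarith
  then show "mu2 \<omega> \<nu> > 0" unfolding mu2_def by simp
  have "?a^2 - (2 * \<omega>^2 - \<nu>^2)^2 = 4 * \<omega>^2 * (1 - \<omega>^2 + \<nu>^2)"
    unfolding a2 n4 by (simp add: power2_eq_square algebra_simps)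
  also have "\<dots> > 0" using w n0 e assms(4) by (intro mult_pos_pos) linarith+
  finally have "(2 * \<omega>^2 - \<nu>^2)^2 < ?a^2" by simp
  then have "2 * \<omega>^2 - \<nu>^2 < ?a" using a by (meson less_imp_le power_less_imp_less_base)
  then show "lam1 \<omega> \<nu> > 0" unfolding lam1_def using a by simp
  have "?a + 2 * \<omega>^2 + \<nu>^2 > 0" using a w n0 by linarith
  then show "lam2 \<omega> \<nu> > 0" unfolding lam2_def using a by simp
qed

end

theory Submission
  imports Defs "HOL-Probability.Probability"
begin

text \<open>
The operator \<open>M\<close> is a composition of elementary unitary maps of the Schwartz space: the Fourier
transform, multiplication by the chirp \<open>exp (2 i \<pi> \<eta>\<^sub>1 \<eta>\<^sub>2 / d)\<close>, the inverse Fourier transform, an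
anisotropic dilation, and again multiplication by a chirp. Each of them conjugates the positions
\<open>x\<^sub>j\<close> and the momenta \<open>D\<^sub>j\<close> into real linear combinations of positions and momenta. Composing
these conjugations shows that \<open>x\<^sub>1\<close>, \<open>x\<^sub>2\<close>, \<open>D\<^sub>1\<close>, \<open>D\<^sub>2\<close> applied to \<open>M u\<close> are \<open>M\<close> applied to the
four rows of \<open>\<chi>\<close>, read as operators on \<open>u\<close>
(\<open>position_quadratic_unitary\<close>, \<open>momentum_quadratic_unitary\<close>).

The Weyl quantization of the quadratic form \<open>q\<close> is the expected differential operator
(\<open>weyl_quadratic\<close>), without ordering corrections, because \<open>q\<close> couples \<open>x\<^sub>1\<close> only with \<open>\<xi>\<^sub>2\<close> and
\<open>x\<^sub>2\<close> only with \<open>\<xi>\<^sub>1\<close>. The rows of \<open>\<chi>\<close> have the same structure: each involves either only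
\<open>y\<^sub>1, \<eta>\<^sub>2\<close> or only \<open>y\<^sub>2, \<eta>\<^sub>1\<close>, and these pairs commute as operators. Hence the algebra that
diagonalizes \<open>q \<circ> \<chi>\<close> as a polynomial is literally the algebra that turns \<open>q\<^sup>w M\<close> into
\<open>M (q \<circ> \<chi>)\<^sup>w\<close>: the six coefficients in \<open>chi_coefficients\<close> are used for both
(\<open>quadratic_operator_intertwine\<close>). Since \<open>M\<close> is unitary, \<open>M\<^sup>* M v = v\<close> for the Schwartz function
\<open>v = (q \<circ> \<chi>)\<^sup>w u\<close> (\<open>adjoint_op_eqI\<close>).

The analytic input is that the Fourier transform is an isometric bijection of the Schwartz space of
the plane. Stability of the Schwartz space under all operations follows from one principle
(\<open>schwartz_coinduct\<close>), and Fourier inversion is obtained by regularizing with a Gaussian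
(\<open>fourier_inversion\<close>).
\<close>

section \<open>The Schwartz space\<close>

text \<open>The Schwartz space is the largest family of differentiable, rapidly decreasing functions that is
stable under the coordinate derivatives. Membership therefore never needs an induction over lists of
derivatives: it suffices to exhibit a stable family that contains the function.\<close>

lemma schwartz_coinduct:
  assumes "f \<in> X"
    and diff: "\<And>g x. g \<in> X \<Longrightarrow> g differentiable at x"
    and decay: "\<And>g k. g \<in> X \<Longrightarrow> \<exists>C. \<forall>x. norm x ^ k * norm (g x) \<le> C"
    and closed: "\<And>g b. g \<in> X \<Longrightarrow> b \<in> Basis \<Longrightarrow> partial_deriv b g \<in> X"
  shows "f \<in> schwartz"
proof -
  have "foldr partial_deriv bs f \<in> X" if "set bs \<subseteq> Basis" for bs
    using that by (induction bs) (auto simp: assms(1) closed)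
  then show ?thesis
    unfolding schwartz_def bounded_iff using diff decay by auto
qed

lemma schwartz_differentiable: "f \<in> schwartz \<Longrightarrow> f differentiable at x"
  unfolding schwartz_def by (auto dest: spec[of _ "[]"])

lemma schwartz_decay:
  assumes "f \<in> schwartz"
  shows "\<exists>C\<ge>0. \<forall>x. norm x ^ k * norm (f x) \<le> C"
proof -
  have "bounded (range (\<lambda>x. norm x ^ k *\<^sub>R foldr partial_deriv [] f x))"
    using assms unfolding schwartz_def by (auto simp del: foldr.simps)
  then obtain C where C: "norm x ^ k * norm (f x) \<le> C" for x
    unfolding bounded_iff by auto
  have "0 \<le> C" using C[of 0] by (rule order_trans[rotated]) simp
  with C show ?thesis by blast
qed

lemma schwartz_bounded: "f \<in> schwartz \<Longrightarrow> \<exists>C\<ge>0. \<forall>x. norm (f x) \<le> C"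
  using schwartz_decay[of f 0] by simp

lemma schwartz_partial_deriv:
  assumes "f \<in> schwartz" "b \<in> Basis"
  shows "partial_deriv b f \<in> schwartz"
proof -
  have "(\<forall>x. foldr partial_deriv bs (partial_deriv b f) differentiable at x) \<and>
     (\<forall>k::nat. bounded (range (\<lambda>x. norm x ^ k *\<^sub>R foldr partial_deriv bs (partial_deriv b f) x)))"
    if "set bs \<subseteq> Basis" for bs
    using assms that unfolding schwartz_def by (auto dest!: spec[of _ "bs @ [b]"])
  then show ?thesis unfolding schwartz_def by blast
qed

lemma partial_deriv_eq:
  "(f has_derivative f') (at x) \<Longrightarrow> partial_deriv b f x = f' b"
  unfolding partial_deriv_def by (metis frechet_derivative_at)

lemma schwartz_has_derivative:
  assumes "f \<in> schwartz"
  shows "(f has_derivative (\<lambda>h. \<Sum>b\<in>Basis. of_real (h \<bullet> b) * partial_deriv b f x)) (at x)"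
proof -
  have d: "(f has_derivative frechet_derivative f (at x)) (at x)"
    using schwartz_differentiable[OF assms] frechet_derivative_works by blast
  then interpret bounded_linear "frechet_derivative f (at x)" by (rule has_derivative_bounded_linear)
  have "frechet_derivative f (at x) h = (\<Sum>b\<in>Basis. of_real (h \<bullet> b) * partial_deriv b f x)" for h
  proof -
    have "frechet_derivative f (at x) h = frechet_derivative f (at x) (\<Sum>b\<in>Basis. (h \<bullet> b) *\<^sub>R b)"
      by (simp add: euclidean_representation)
    then show ?thesis
      by (simp add: sum scale partial_deriv_def scaleR_conv_of_real)
  qed
  then have "frechet_derivative f (at x) = (\<lambda>h. \<Sum>b\<in>Basis. of_real (h \<bullet> b) * partial_deriv b f x)"
    by (rule ext)
  with d show ?thesis by metis
qed

lemma schwartz_continuous: "f \<in> schwartz \<Longrightarrow> continuous_on UNIV f"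
  by (meson continuous_at_imp_continuous_on differentiable_imp_continuous_within schwartz_differentiable)

lemma schwartz_measurable [measurable_dest]: "f \<in> schwartz \<Longrightarrow> f \<in> borel_measurable borel"
  by (intro borel_measurable_continuous_onI schwartz_continuous)

lemma partial_deriv_lincomb:
  assumes "f \<in> schwartz" "g \<in> schwartz"
  shows "partial_deriv b (\<lambda>x. p * f x + q * g x) = (\<lambda>x. p * partial_deriv b f x + q * partial_deriv b g x)"
proof
  fix x
  have "(f has_derivative frechet_derivative f (at x)) (at x)"
    "(g has_derivative frechet_derivative g (at x)) (at x)"
    using schwartz_differentiable assms frechet_derivative_works by blast+
  then have "((\<lambda>x. p * f x + q * g x) has_derivative
     (\<lambda>h. p * frechet_derivative f (at x) h + q * frechet_derivative g (at x) h)) (at x)"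
    by (intro derivative_intros)
  from partial_deriv_eq[OF this]
  show "partial_deriv b (\<lambda>x. p * f x + q * g x) x = p * partial_deriv b f x + q * partial_deriv b g x"
    by (simp add: partial_deriv_def)
qed

lemma schwartz_lincomb:
  fixes f g :: "'a::euclidean_space \<Rightarrow> complex"
  assumes "f \<in> schwartz" "g \<in> schwartz"
  shows "(\<lambda>x. p * f x + q * g x) \<in> schwartz"
proof (rule schwartz_coinduct[where X = "{\<lambda>x. p * f x + q * g x |f g. f \<in> schwartz \<and> g \<in> schwartz}"])
  show "(\<lambda>x. p * f x + q * g x) \<in> {\<lambda>x. p * f x + q * g x |f g. f \<in> schwartz \<and> g \<in> schwartz}"
    using assms by blast
next
  fix h x assume "h \<in> {\<lambda>x. p * f x + q * g x |f g. f \<in> schwartz \<and> g \<in> schwartz}"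
  then show "h differentiable at x"
    by (auto intro!: differentiable_add differentiable_mult differentiable_const dest: schwartz_differentiable)
next
  fix h and k :: nat assume "h \<in> {\<lambda>x. p * f x + q * g x |f g. f \<in> schwartz \<and> g \<in> schwartz}"
  then obtain f g where h: "h = (\<lambda>x. p * f x + q * g x)" "f \<in> schwartz" "g \<in> schwartz" by blast
  obtain C C' where C: "\<And>x. norm x ^ k * norm (f x) \<le> C" "\<And>x. norm x ^ k * norm (g x) \<le> C'"
    using h schwartz_decay by meson
  have "norm x ^ k * norm (h x) \<le> norm p * C + norm q * C'" for x
  proof -
    have "norm x ^ k * norm (h x) \<le> norm x ^ k * (norm p * norm (f x) + norm q * norm (g x))"
      unfolding h by (intro mult_left_mono norm_triangle_le) (auto simp: norm_mult)
    also have "\<dots> = norm p * (norm x ^ k * norm (f x)) + norm q * (norm x ^ k * norm (g x))"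
      by (simp add: algebra_simps)
    also have "\<dots> \<le> norm p * C + norm q * C'"
      by (intro add_mono mult_left_mono C) auto
    finally show ?thesis .
  qed
  then show "\<exists>C. \<forall>x. norm x ^ k * norm (h x) \<le> C" by blast
next
  fix h :: "'a \<Rightarrow> complex" and b :: 'a assume "h \<in> {\<lambda>x. p * f x + q * g x |f g. f \<in> schwartz \<and> g \<in> schwartz}" "b \<in> Basis"
  then show "partial_deriv b h \<in> {\<lambda>x. p * f x + q * g x |f g. f \<in> schwartz \<and> g \<in> schwartz}"
    using partial_deriv_lincomb schwartz_partial_deriv by blast
qed

lemma schwartz_scale: "f \<in> schwartz \<Longrightarrow> (\<lambda>x. p * f x) \<in> schwartz"
  using schwartz_lincomb[of f f p 0] by simp

lemma schwartz_add: "f \<in> schwartz \<Longrightarrow> g \<in> schwartz \<Longrightarrow> (\<lambda>x. f x + g x) \<in> schwartz"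
  using schwartz_lincomb[of f g 1 1] by simp

lemma schwartz_zero: "(\<lambda>x. 0) \<in> schwartz"
proof (rule schwartz_coinduct[where X = "{\<lambda>x. 0}"])
  fix g :: "'a \<Rightarrow> complex" and b :: 'a assume g: "g \<in> {\<lambda>x. 0}"
  have "partial_deriv b g x = 0" for x
    using g partial_deriv_eq[of g "\<lambda>_. 0"] by simp
  then show "partial_deriv b g \<in> {\<lambda>x. 0}" by auto
qed auto

lemma schwartz_sum:
  assumes "\<And>i. i \<in> I \<Longrightarrow> f i \<in> schwartz"
  shows "(\<lambda>x. \<Sum>i\<in>I. f i x) \<in> schwartz"
  using assms by (induction I rule: infinite_finite_induct) (auto simp: schwartz_zero schwartz_add)

lemma partial_deriv_coord_mult:
  assumes "f \<in> schwartz"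
  shows "partial_deriv b (\<lambda>x. of_real (x \<bullet> a) * f x)
     = (\<lambda>x. of_real (b \<bullet> a) * f x + of_real (x \<bullet> a) * partial_deriv b f x)"
proof
  fix x
  have "(f has_derivative frechet_derivative f (at x)) (at x)"
    using schwartz_differentiable assms frechet_derivative_works by blast
  then have "((\<lambda>x. of_real (x \<bullet> a) * f x) has_derivative
     (\<lambda>h. of_real (x \<bullet> a) * frechet_derivative f (at x) h + of_real (h \<bullet> a) * f x)) (at x)"
    by (auto intro!: derivative_eq_intros)
  from partial_deriv_eq[OF this]
  show "partial_deriv b (\<lambda>x. of_real (x \<bullet> a) * f x) x =
      of_real (b \<bullet> a) * f x + of_real (x \<bullet> a) * partial_deriv b f x"
    by (simp add: partial_deriv_def)
qed

text \<open>The product rule produces a term without the factor \<open>x \<bullet> a\<close>, so the multiples alone do not form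
a stable family; allowing a Schwartz remainder repairs this.\<close>

lemma schwartz_coord_mult:
  assumes "f \<in> schwartz"
  shows "(\<lambda>x. of_real (x \<bullet> a) * f x) \<in> schwartz"
proof (rule schwartz_coinduct[where X = "{\<lambda>x. of_real (x \<bullet> a) * g x + h x |g h. g \<in> schwartz \<and> h \<in> schwartz}"])
  show "(\<lambda>x. of_real (x \<bullet> a) * f x) \<in> {\<lambda>x. of_real (x \<bullet> a) * g x + h x |g h. g \<in> schwartz \<and> h \<in> schwartz}"
    using assms schwartz_zero by force
next
  fix f x assume "f \<in> {\<lambda>x. of_real (x \<bullet> a) * g x + h x |g h. g \<in> schwartz \<and> h \<in> schwartz}"
  moreover have "(\<lambda>x. of_real (x \<bullet> a) :: complex) differentiable at x"
    unfolding differentiable_def by (rule exI) (auto intro!: derivative_eq_intros)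
  ultimately show "f differentiable at x"
    by (auto intro!: differentiable_add differentiable_mult dest: schwartz_differentiable)
next
  fix f and k :: nat assume "f \<in> {\<lambda>x. of_real (x \<bullet> a) * g x + h x |g h. g \<in> schwartz \<and> h \<in> schwartz}"
  then obtain g h where f: "f = (\<lambda>x. of_real (x \<bullet> a) * g x + h x)" "g \<in> schwartz" "h \<in> schwartz" by blast
  obtain C C' where C: "\<And>x. norm x ^ Suc k * norm (g x) \<le> C" "\<And>x. norm x ^ k * norm (h x) \<le> C'"
    using f schwartz_decay by meson
  have "norm x ^ k * norm (f x) \<le> norm a * C + C'" for x
  proof -
    have "norm x ^ k * norm (f x) \<le> norm x ^ k * ((norm x * norm a) * norm (g x) + norm (h x))"
      unfolding f by (intro mult_left_mono norm_triangle_le add_mono)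
        (auto simp: norm_mult intro!: mult_right_mono Cauchy_Schwarz_ineq2)
    also have "\<dots> = norm a * (norm x ^ Suc k * norm (g x)) + norm x ^ k * norm (h x)"
      by (simp add: algebra_simps)
    also have "\<dots> \<le> norm a * C + C'"
      by (intro add_mono mult_left_mono C) auto
    finally show ?thesis .
  qed
  then show "\<exists>C. \<forall>x. norm x ^ k * norm (f x) \<le> C" by blast
next
  fix f and b :: 'a assume "f \<in> {\<lambda>x. of_real (x \<bullet> a) * g x + h x |g h. g \<in> schwartz \<and> h \<in> schwartz}"
    and b: "b \<in> Basis"
  then obtain g h where f: "f = (\<lambda>x. of_real (x \<bullet> a) * g x + h x)" "g \<in> schwartz" "h \<in> schwartz" by blast
  have "partial_deriv b f x = of_real (x \<bullet> a) * partial_deriv b g x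
      + (of_real (b \<bullet> a) * g x + 1 * partial_deriv b h x)" for x
  proof -
    have "(g has_derivative frechet_derivative g (at x)) (at x)"
      "(h has_derivative frechet_derivative h (at x)) (at x)"
      using schwartz_differentiable f frechet_derivative_works by blast+
    then have "(f has_derivative
       (\<lambda>v. of_real (x \<bullet> a) * frechet_derivative g (at x) v + of_real (v \<bullet> a) * g x
          + frechet_derivative h (at x) v)) (at x)"
      unfolding f(1) by (auto intro!: derivative_eq_intros)
    from partial_deriv_eq[OF this] show ?thesis
      by (simp add: partial_deriv_def)
  qed
  moreover have "(\<lambda>x. of_real (b \<bullet> a) * g x + 1 * partial_deriv b h x) \<in> schwartz"
    using f b by (intro schwartz_lincomb schwartz_partial_deriv)
  ultimately show "partial_deriv b f \<in> {\<lambda>x. of_real (x \<bullet> a) * g x + h x |g h. g \<in> schwartz \<and> h \<in> schwartz}"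
    using f b schwartz_partial_deriv by (intro CollectI exI[of _ "partial_deriv b g"]
        exI[of _ "\<lambda>x. of_real (b \<bullet> a) * g x + 1 * partial_deriv b h x"]) auto
qed

lemma partial_deriv_unimodular_mult:
  assumes "f \<in> schwartz" and \<phi>: "(\<phi> has_derivative \<phi>') (at x)"
  shows "partial_deriv b (\<lambda>x. exp (\<i> * of_real (\<phi> x)) * f x) x
     = exp (\<i> * of_real (\<phi> x)) * (\<i> * (of_real (\<phi>' b) * f x) + partial_deriv b f x)"
    and "(\<lambda>x. exp (\<i> * of_real (\<phi> x)) * f x) differentiable at x"
proof -
  have f: "(f has_derivative frechet_derivative f (at x)) (at x)"
    using schwartz_differentiable assms frechet_derivative_works by blast
  have "(exp has_derivative (\<lambda>h. h * exp (\<i> * of_real (\<phi> x)))) (at (\<i> * of_real (\<phi> x)))"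
    using DERIV_exp[of "\<i> * of_real (\<phi> x)"] unfolding has_field_derivative_def
    by (simp add: mult.commute[of _ "exp _"])
  moreover have "((\<lambda>x. \<i> * of_real (\<phi> x)) has_derivative (\<lambda>h. \<i> * of_real (\<phi>' h))) (at x)"
    by (auto intro!: derivative_eq_intros \<phi>)
  ultimately have e: "((\<lambda>x. exp (\<i> * of_real (\<phi> x))) has_derivative
      (\<lambda>h. (\<i> * of_real (\<phi>' h)) * exp (\<i> * of_real (\<phi> x)))) (at x)"
    using has_derivative_compose by fastforce
  note d = has_derivative_mult[OF e f]
  then show "(\<lambda>x. exp (\<i> * of_real (\<phi> x)) * f x) differentiable at x"
    by (auto simp: differentiable_def)
  from partial_deriv_eq[OF d] show "partial_deriv b (\<lambda>x. exp (\<i> * of_real (\<phi> x)) * f x) x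
     = exp (\<i> * of_real (\<phi> x)) * (\<i> * (of_real (\<phi>' b) * f x) + partial_deriv b f x)"
    by (simp add: partial_deriv_def algebra_simps)
qed

text \<open>A derivative of \<open>exp (i \<phi>) g\<close> is again \<open>exp (i \<phi>)\<close> times a Schwartz function as soon as the partial
derivatives of \<open>\<phi>\<close> are multipliers of the Schwartz space. This covers characters (constant
derivatives) and chirps (linear derivatives) at once.\<close>

lemma schwartz_unimodular_mult:
  fixes f :: "'a::euclidean_space \<Rightarrow> complex"
  assumes "f \<in> schwartz" and \<phi>: "\<And>x. (\<phi> has_derivative \<phi>' x) (at x)"
    and mult: "\<And>b g. b \<in> Basis \<Longrightarrow> g \<in> schwartz \<Longrightarrow> (\<lambda>x. of_real (\<phi>' x b) * g x) \<in> schwartz"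
  shows "(\<lambda>x. exp (\<i> * of_real (\<phi> x)) * f x) \<in> schwartz"
proof (rule schwartz_coinduct[where X = "{\<lambda>x. exp (\<i> * of_real (\<phi> x)) * g x |g. g \<in> schwartz}"])
  fix h :: "'a \<Rightarrow> complex" and b :: 'a assume "h \<in> {\<lambda>x. exp (\<i> * of_real (\<phi> x)) * g x |g. g \<in> schwartz}" and b: "b \<in> Basis"
  then obtain g where h: "h = (\<lambda>x. exp (\<i> * of_real (\<phi> x)) * g x)" "g \<in> schwartz" by blast
  have "partial_deriv b h =
     (\<lambda>x. exp (\<i> * of_real (\<phi> x)) * (\<i> * (of_real (\<phi>' x b) * g x) + 1 * partial_deriv b g x))"
    unfolding h using partial_deriv_unimodular_mult(1)[OF h(2) \<phi>] by auto
  moreover have "(\<lambda>x. \<i> * (of_real (\<phi>' x b) * g x) + 1 * partial_deriv b g x) \<in> schwartz"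
    using h b by (intro schwartz_lincomb schwartz_partial_deriv mult)
  ultimately show "partial_deriv b h \<in> {\<lambda>x. exp (\<i> * of_real (\<phi> x)) * g x |g. g \<in> schwartz}"
    by (intro CollectI exI conjI)
next
  fix h and k :: nat assume "h \<in> {\<lambda>x. exp (\<i> * of_real (\<phi> x)) * g x |g. g \<in> schwartz}"
  then obtain g where "h = (\<lambda>x. exp (\<i> * of_real (\<phi> x)) * g x)" "g \<in> schwartz" by blast
  then show "\<exists>C. \<forall>x. norm x ^ k * norm (h x) \<le> C"
    using schwartz_decay[of g k] by (auto simp: norm_mult)
next
  fix h x assume "h \<in> {\<lambda>x. exp (\<i> * of_real (\<phi> x)) * g x |g. g \<in> schwartz}"
  then show "h differentiable at x" using partial_deriv_unimodular_mult(2)[OF _ \<phi>] by blast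
qed (use assms in auto)

lemma partial_deriv_comp_linear:
  assumes "f \<in> schwartz" and A: "bounded_linear A"
  shows "partial_deriv b (\<lambda>x. f (A x)) x
     = (\<Sum>e\<in>Basis. of_real (A b \<bullet> e) * partial_deriv e f (A x))"
    and "(\<lambda>x. f (A x)) differentiable at x"
proof -
  have "((\<lambda>x. f (A x)) has_derivative
     (\<lambda>h. \<Sum>e\<in>Basis. of_real (A h \<bullet> e) * partial_deriv e f (A x))) (at x)"
    using has_derivative_compose[OF bounded_linear_imp_has_derivative[OF A]
        schwartz_has_derivative[OF assms(1)]] .
  then show "(\<lambda>x. f (A x)) differentiable at x"
     "partial_deriv b (\<lambda>x. f (A x)) x = (\<Sum>e\<in>Basis. of_real (A b \<bullet> e) * partial_deriv e f (A x))"
    by (auto simp: differentiable_def partial_deriv_eq)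
qed

text \<open>The lower bound on \<open>A\<close> is what transfers the decay in \<open>A x\<close> to decay in \<open>x\<close>.\<close>

lemma schwartz_comp_linear:
  fixes A :: "'a::euclidean_space \<Rightarrow> 'b::euclidean_space"
  assumes "f \<in> schwartz" and A: "bounded_linear A" and inj: "\<And>x. norm x \<le> K * norm (A x)" and "K \<ge> 0"
  shows "(\<lambda>x. f (A x)) \<in> schwartz"
proof (rule schwartz_coinduct[where X = "{\<lambda>x. g (A x) |g. g \<in> schwartz}"])
  fix h and k :: nat assume "h \<in> {\<lambda>x. g (A x) |g. g \<in> schwartz}"
  then obtain g where h: "h = (\<lambda>x. g (A x))" "g \<in> schwartz" by blast
  obtain C where C: "\<And>x. norm x ^ k * norm (g x) \<le> C" using h schwartz_decay by meson
  have "norm x ^ k * norm (h x) \<le> K ^ k * C" for x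
  proof -
    have "norm x ^ k * norm (h x) \<le> (K * norm (A x)) ^ k * norm (h x)"
      by (intro mult_right_mono power_mono inj) auto
    also have "\<dots> = K ^ k * (norm (A x) ^ k * norm (g (A x)))" by (simp add: h power_mult_distrib)
    also have "\<dots> \<le> K ^ k * C" using \<open>K \<ge> 0\<close> by (intro mult_left_mono C) auto
    finally show ?thesis .
  qed
  then show "\<exists>C. \<forall>x. norm x ^ k * norm (h x) \<le> C" by blast
next
  fix h and b :: 'a assume "h \<in> {\<lambda>x. g (A x) |g. g \<in> schwartz}" and b: "b \<in> Basis"
  then obtain g where h: "h = (\<lambda>x. g (A x))" "g \<in> schwartz" by blast
  have "(\<lambda>y. \<Sum>e\<in>Basis. of_real (A b \<bullet> e) * partial_deriv e g y) \<in> schwartz"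
    using h by (intro schwartz_sum schwartz_scale schwartz_partial_deriv)
  moreover have "partial_deriv b h = (\<lambda>x. \<Sum>e\<in>Basis. of_real (A b \<bullet> e) * partial_deriv e g (A x))"
    unfolding h using partial_deriv_comp_linear(1)[OF h(2) A] by blast
  ultimately show "partial_deriv b h \<in> {\<lambda>x. g (A x) |g. g \<in> schwartz}" by force
next
  fix h x assume "h \<in> {\<lambda>x. g (A x) |g. g \<in> schwartz}"
  then show "h differentiable at x" using partial_deriv_comp_linear(2)[OF _ A] by blast
qed (use assms in auto)

section \<open>Integrals of Schwartz functions on the plane\<close>

lemma Basis_plane: "(Basis :: plane set) = {(1, 0), (0, 1)}"
  by (auto simp: Basis_prod_def)

lemma tensor_integral:
  fixes g h :: "real \<Rightarrow> complex"
  assumes [simp]: "integrable lborel g" "integrable lborel h"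
  shows "integrable lborel (\<lambda>x::plane. g (fst x) * h (snd x))"
    and "(\<integral>x. g (fst (x::plane)) * h (snd x) \<partial>lborel) = (\<integral>s. g s \<partial>lborel) * (\<integral>t. h t \<partial>lborel)"
proof -
  have [measurable]: "g \<in> borel_measurable borel" "h \<in> borel_measurable borel"
    using borel_measurable_integrable[OF assms(1)] borel_measurable_integrable[OF assms(2)] by simp_all
  have int: "integrable (lborel \<Otimes>\<^sub>M lborel) (\<lambda>(s, t). g s * h t)"
    by (rule lborel_pair.Fubini_integrable) (auto simp: norm_mult)
  then show "integrable lborel (\<lambda>x::plane. g (fst x) * h (snd x))"
    by (simp add: lborel_prod case_prod_unfold)
  show "(\<integral>x. g (fst (x::plane)) * h (snd x) \<partial>lborel) = (\<integral>s. g s \<partial>lborel) * (\<integral>t. h t \<partial>lborel)"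
    using lborel_pair.integral_fst[OF int] by (simp add: lborel_prod case_prod_unfold)
qed

lemma integrable_inverse_one_plus_square: "integrable lborel (\<lambda>t::real. inverse (1 + t\<^sup>2))"
  using integrable_inverse_1_plus_square by (simp add: set_integrable_def)

lemma integrable_plane_majorant:
  "integrable lborel (\<lambda>x::plane. inverse (1 + (fst x)\<^sup>2) * inverse (1 + (snd x)\<^sup>2))"
proof -
  have "integrable lborel (\<lambda>t::real. complex_of_real (inverse (1 + t\<^sup>2)))"
    by (intro integrable_of_real integrable_inverse_one_plus_square)
  from tensor_integral(1)[OF this this]
  have "integrable lborel (\<lambda>x::plane. Re (complex_of_real (inverse (1 + (fst x)\<^sup>2))
     * complex_of_real (inverse (1 + (snd x)\<^sup>2))))"
    by (rule integrable_Re)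
  then show ?thesis by (simp only: of_real_mult[symmetric] Re_complex_of_real)
qed

text \<open>Since \<open>(1 + x\<^sub>1\<^sup>2) (1 + x\<^sub>2\<^sup>2) \<le> (1 + \<bar>x\<bar>\<^sup>2)\<^sup>2\<close>, the decay of orders 0, 2 and 4 gives a bound by a
tensor product, whose integral is finite by Fubini.\<close>

lemma schwartz_plane_decay:
  fixes f :: "plane \<Rightarrow> complex"
  assumes "f \<in> schwartz"
  shows "\<exists>C\<ge>0. \<forall>x. norm (f x) \<le> C * (inverse (1 + (fst x)\<^sup>2) * inverse (1 + (snd x)\<^sup>2))"
proof -
  obtain C0 where C0: "C0 \<ge> 0" "\<And>x. norm (f x) \<le> C0"
    using schwartz_bounded[OF assms] by blast
  obtain C2 where C2: "C2 \<ge> 0" "\<And>x. norm x ^ 2 * norm (f x) \<le> C2"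
    using schwartz_decay[OF assms] by blast
  obtain C4 where C4: "C4 \<ge> 0" "\<And>x. norm x ^ 4 * norm (f x) \<le> C4"
    using schwartz_decay[OF assms] by blast
  have "norm (f x) \<le> (C0 + 2 * C2 + C4) * (inverse (1 + (fst x)\<^sup>2) * inverse (1 + (snd x)\<^sup>2))" for x
  proof -
    have n: "(norm x)\<^sup>2 = (fst x)\<^sup>2 + (snd x)\<^sup>2"
      by (simp add: norm_prod_def)
    have pos: "0 < 1 + (fst x)\<^sup>2" "0 < 1 + (snd x)\<^sup>2" by (simp_all add: add_pos_nonneg)
    have "(1 + (fst x)\<^sup>2) * (1 + (snd x)\<^sup>2) \<le> (1 + (norm x)\<^sup>2) * (1 + (norm x)\<^sup>2)"
      unfolding n by (intro mult_mono) auto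
    also have "\<dots> = 1 + 2 * norm x ^ 2 + norm x ^ 4" by algebra
    finally have "(1 + (fst x)\<^sup>2) * (1 + (snd x)\<^sup>2) * norm (f x) \<le> (1 + 2 * norm x ^ 2 + norm x ^ 4) * norm (f x)"
      by (rule mult_right_mono) auto
    also have "\<dots> = norm (f x) + 2 * (norm x ^ 2 * norm (f x)) + norm x ^ 4 * norm (f x)" by algebra
    also have "\<dots> \<le> C0 + 2 * C2 + C4" using C0(2)[of x] C2(2)[of x] C4(2)[of x] by linarith
    finally show ?thesis using mult_pos_pos[OF pos]
      unfolding inverse_mult_distrib[symmetric] unfolding divide_inverse[symmetric]
      by (simp only: pos_le_divide_eq mult.commute)
  qed
  then show ?thesis using C0(1) C2(1) C4(1) by (intro exI[of _ "C0 + 2 * C2 + C4"]) auto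
qed

lemma integrable_schwartz:
  fixes f :: "plane \<Rightarrow> complex"
  assumes "f \<in> schwartz"
  shows "integrable lborel f"
proof -
  obtain C where C: "C \<ge> 0" "\<And>x. norm (f x) \<le> C * (inverse (1 + (fst x)\<^sup>2) * inverse (1 + (snd x)\<^sup>2))"
    using schwartz_plane_decay[OF assms] by blast
  show ?thesis
    by (rule Bochner_Integration.integrable_bound[OF integrable_mult_right[OF integrable_plane_majorant, of C]])
      (use C assms in \<open>auto intro!: AE_I2 simp: abs_mult schwartz_measurable\<close>)
qed

lemma integrable_mult_bounded:
  fixes f g :: "'a \<Rightarrow> complex"
  assumes "integrable M f" "g \<in> borel_measurable M" "\<And>x. norm (g x) \<le> C"
  shows "integrable M (\<lambda>x. g x * f x)"
proof (rule Bochner_Integration.integrable_bound)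
  show "integrable M (\<lambda>x. C * norm (f x))" using assms by auto
  show "(\<lambda>x. g x * f x) \<in> borel_measurable M" using assms by auto
  show "AE x in M. norm (g x * f x) \<le> norm (C * norm (f x))"
    using assms(3) order_trans[OF norm_ge_zero assms(3)]
    by (auto simp: norm_mult abs_mult intro!: mult_right_mono)
qed

text \<open>The fundamental theorem of calculus on the whole line; the boundary terms vanish by decay. The
condition \<open>p \<bullet> b = 0\<close> makes \<open>t\<close> a coordinate of the point \<open>p + t b\<close>, so that the decay in the norm
yields decay in \<open>t\<close>.\<close>

lemma integral_line_partial_deriv:
  assumes g: "g \<in> schwartz" and b: "b \<in> Basis" and p: "p \<bullet> b = 0"
  shows "(\<integral>t. partial_deriv b g (p + t *\<^sub>R b) \<partial>lborel) = 0"
proof -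
  have decay: "\<exists>C\<ge>0. \<forall>t. norm (f (p + t *\<^sub>R b)) \<le> C * inverse (1 + t\<^sup>2)" if "f \<in> schwartz" for f
  proof -
    obtain C0 where C0: "C0 \<ge> 0" "\<And>x. norm (f x) \<le> C0"
      using schwartz_bounded[OF \<open>f \<in> schwartz\<close>] by blast
    obtain C2 where C2: "C2 \<ge> 0" "\<And>x. norm x ^ 2 * norm (f x) \<le> C2"
      using schwartz_decay[OF \<open>f \<in> schwartz\<close>] by blast
    have "norm (f (p + t *\<^sub>R b)) \<le> (C0 + C2) * inverse (1 + t\<^sup>2)" for t
    proof -
      have "\<bar>t\<bar> = \<bar>(p + t *\<^sub>R b) \<bullet> b\<bar>" using p b by (simp add: inner_add_left)
      also have "\<dots> \<le> norm (p + t *\<^sub>R b)" using b by (rule Basis_le_norm)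
      finally have "t\<^sup>2 \<le> (norm (p + t *\<^sub>R b))\<^sup>2" by (rule power2_le_iff_abs_le[THEN iffD2, rotated]) simp
      then have "t\<^sup>2 * norm (f (p + t *\<^sub>R b)) \<le> C2"
        using C2(2)[of "p + t *\<^sub>R b"] by (meson mult_right_mono norm_ge_zero order_trans)
      then have "(1 + t\<^sup>2) * norm (f (p + t *\<^sub>R b)) \<le> C0 + C2"
        using C0(2)[of "p + t *\<^sub>R b"] by (simp add: algebra_simps)
      moreover have "0 < 1 + t\<^sup>2" by (simp add: add_pos_nonneg)
      ultimately show ?thesis by (simp add: field_simps)
    qed
    then show ?thesis using C0 C2 by (intro exI[of _ "C0 + C2"]) auto
  qed
  have h: "partial_deriv b g \<in> schwartz" using g b by (rule schwartz_partial_deriv)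
  obtain C where C: "C \<ge> 0" "\<And>t. norm (g (p + t *\<^sub>R b)) \<le> C * inverse (1 + t\<^sup>2)"
    using decay[OF g] by blast
  obtain C' where C': "C' \<ge> 0" "\<And>t. norm (partial_deriv b g (p + t *\<^sub>R b)) \<le> C' * inverse (1 + t\<^sup>2)"
    using decay[OF h] by blast
  have cont: "continuous_on UNIV (\<lambda>t. partial_deriv b g (p + t *\<^sub>R b))"
    by (rule continuous_on_compose2[OF schwartz_continuous[OF h]]) (auto intro!: continuous_intros)
  have int: "integrable lborel (\<lambda>t. partial_deriv b g (p + t *\<^sub>R b))"
    by (rule Bochner_Integration.integrable_bound[OF integrable_mult_right[OF integrable_inverse_one_plus_square, of C']])
      (use C' cont in \<open>auto intro!: AE_I2 borel_measurable_continuous_onI simp: abs_mult\<close>)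
  have zero: "((\<lambda>t. g (p + t *\<^sub>R b)) \<longlongrightarrow> 0) F" if "((\<lambda>t. inverse (1 + t\<^sup>2)) \<longlongrightarrow> 0) F" for F
  proof (rule Lim_null_comparison)
    show "((\<lambda>t. C * inverse (1 + t\<^sup>2)) \<longlongrightarrow> 0) F" using tendsto_mult_right_zero[OF that] .
  qed (use C in auto)
  have top: "((\<lambda>t. inverse (1 + t\<^sup>2)) \<longlongrightarrow> (0::real)) at_top" by real_asymp
  have bot: "((\<lambda>t. inverse (1 + t\<^sup>2)) \<longlongrightarrow> (0::real)) at_bot" by real_asymp
  have "(LBINT t=-\<infinity>..\<infinity>. partial_deriv b g (p + t *\<^sub>R b)) = 0 - 0"
  proof (rule interval_integral_FTC_integrable)
    fix t
    have "((\<lambda>t. g (p + t *\<^sub>R b)) has_derivative (\<lambda>s. frechet_derivative g (at (p + t *\<^sub>R b)) (s *\<^sub>R b))) (at t)"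
      using schwartz_differentiable[OF g]
      by (intro has_derivative_compose[of "\<lambda>t. p + t *\<^sub>R b", OF _ frechet_derivative_works[THEN iffD1]])
        (auto intro!: derivative_eq_intros)
    moreover have "linear (frechet_derivative g (at (p + t *\<^sub>R b)))"
      using schwartz_differentiable[OF g] linear_frechet_derivative by blast
    ultimately show "((\<lambda>t. g (p + t *\<^sub>R b)) has_vector_derivative partial_deriv b g (p + t *\<^sub>R b)) (at t)"
      by (simp add: has_vector_derivative_def partial_deriv_def linear_cmul)
  next
    fix t show "isCont (\<lambda>t. partial_deriv b g (p + t *\<^sub>R b)) t"
      using cont by (simp add: continuous_on_eq_continuous_at)
  next
    show "set_integrable lborel (einterval (-\<infinity>) \<infinity>) (\<lambda>t. partial_deriv b g (p + t *\<^sub>R b))"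
      using int by (simp add: set_integrable_def)
  qed (use zero[OF top] zero[OF bot] in \<open>auto simp: ereal_tendsto_simps\<close>)
  then show ?thesis
    by (simp add: interval_lebesgue_integral_def set_lebesgue_integral_def)
qed

text \<open>Fubini, with the inner integral taken along the direction of differentiation.\<close>

lemma integral_partial_deriv:
  fixes g :: "plane \<Rightarrow> complex"
  assumes g: "g \<in> schwartz" and b: "b \<in> Basis"
  shows "(\<integral>x. partial_deriv b g x \<partial>lborel) = 0"
proof -
  have int: "integrable (lborel \<Otimes>\<^sub>M lborel) (\<lambda>(s, t). partial_deriv b g (s, t))"
    using integrable_schwartz[OF schwartz_partial_deriv[OF g b]] by (simp add: lborel_prod)
  consider "b = (1, 0)" | "b = (0, 1)" using b by (auto simp: Basis_plane)
  then show ?thesis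
  proof cases
    case 1
    have "(\<integral>s. partial_deriv b g (s, t) \<partial>lborel) = 0" for t
      using integral_line_partial_deriv[OF g b, of "(0, t)"] 1 by (simp add: inner_prod_def)
    then show ?thesis using lborel_pair.integral_snd[OF int] by (simp add: lborel_prod)
  next
    case 2
    have "(\<integral>t. partial_deriv b g (s, t) \<partial>lborel) = 0" for s
      using integral_line_partial_deriv[OF g b, of "(s, 0)"] 2 by (simp add: inner_prod_def)
    then show ?thesis using lborel_pair.integral_fst[OF int] by (simp add: lborel_prod)
  qed
qed

section \<open>The Fourier transform preserves the Schwartz space\<close>

text \<open>Writing the kernel as \<open>exp (i \<phi>)\<close> with a real phase \<open>\<phi>\<close> makes the lemmas on unimodular factors
applicable.\<close>

lemma fourier_alt: "fourier u \<xi> = (\<integral>x. exp (\<i> * of_real (- 2 * pi * (x \<bullet> \<xi>))) * u x \<partial>lborel)"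
  unfolding fourier_def by (simp add: mult_ac)

lemma integrable_phase_mult:
  fixes u :: "'a \<Rightarrow> complex"
  assumes "integrable M u" "\<phi> \<in> borel_measurable M"
  shows "integrable M (\<lambda>x. exp (\<i> * complex_of_real (\<phi> x)) * u x)"
proof -
  have "(\<lambda>x. exp (\<i> * complex_of_real (\<phi> x))) \<in> borel_measurable M"
    using assms(2) by measurable
  then show ?thesis by (rule integrable_mult_bounded[OF assms(1), where C=1]) simp
qed

lemma fourier_lincomb:
  assumes "integrable lborel f" "integrable lborel g"
  shows "fourier (\<lambda>x. p * f x + q * g x) \<xi> = p * fourier f \<xi> + q * fourier g \<xi>"
proof -
  have "integrable lborel (\<lambda>x. exp (\<i> * of_real (- 2 * pi * (x \<bullet> \<xi>))) * f x)"
    "integrable lborel (\<lambda>x. exp (\<i> * of_real (- 2 * pi * (x \<bullet> \<xi>))) * g x)"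
    by (intro integrable_phase_mult assms, measurable)+
  then show ?thesis
    unfolding fourier_alt by (simp add: distrib_left mult.left_commute)
qed

lemma fourier_bounded: "norm (fourier u \<xi>) \<le> (\<integral>x. norm (u x) \<partial>lborel)"
  unfolding fourier_alt by (rule order_trans[OF integral_norm_bound]) (simp add: norm_mult)

text \<open>Integration by parts, in the form that the derivative of the Schwartz function
\<open>exp (- 2 i \<pi> x \<bullet> \<xi>) u\<close> has integral zero.\<close>

lemma fourier_partial_deriv:
  fixes u :: "plane \<Rightarrow> complex"
  assumes u: "u \<in> schwartz" and b: "b \<in> Basis"
  shows "fourier (partial_deriv b u) \<xi> = 2 * \<i> * pi * of_real (\<xi> \<bullet> b) * fourier u \<xi>"
proof -
  define \<phi> where "\<phi> x = - 2 * pi * (x \<bullet> \<xi>)" for x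
  have d: "(\<phi> has_derivative (\<lambda>h. - 2 * pi * (h \<bullet> \<xi>))) (at x)" for x
    unfolding \<phi>_def by (auto intro!: derivative_eq_intros)
  define g where "g x = exp (\<i> * of_real (\<phi> x)) * u x" for x
  have "g \<in> schwartz" unfolding g_def
    by (rule schwartz_unimodular_mult[OF u d schwartz_scale])
  then have "(\<integral>x. partial_deriv b g x \<partial>lborel) = 0" using b by (rule integral_partial_deriv)
  moreover have "partial_deriv b g x = exp (\<i> * of_real (\<phi> x)) * partial_deriv b u x
       - 2 * \<i> * pi * of_real (\<xi> \<bullet> b) * (exp (\<i> * of_real (\<phi> x)) * u x)" for x
    unfolding g_def partial_deriv_unimodular_mult(1)[OF u d] by (simp add: algebra_simps inner_commute)
  moreover have "integrable lborel (\<lambda>x. exp (\<i> * of_real (\<phi> x)) * u x)"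
      "integrable lborel (\<lambda>x. exp (\<i> * of_real (\<phi> x)) * partial_deriv b u x)"
    unfolding \<phi>_def by (intro integrable_phase_mult integrable_schwartz schwartz_partial_deriv u b, measurable)+
  ultimately show ?thesis
    unfolding fourier_alt \<phi>_def[symmetric] by simp
qed

lemma has_derivative_quadratic_remainder:
  fixes f :: "'a::real_normed_vector \<Rightarrow> 'b::real_normed_vector"
  assumes "bounded_linear L" and "K \<ge> 0"
    and rem: "\<And>h. norm (f (x + h) - f x - L h) \<le> K * (norm h)\<^sup>2"
  shows "(f has_derivative L) (at x)"
  unfolding has_derivative_at_alt
proof (intro conjI allI impI)
  fix e :: real assume e: "0 < e"
  show "\<exists>d>0. \<forall>y. norm (y - x) < d \<longrightarrow> norm (f y - f x - L (y - x)) \<le> e * norm (y - x)"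
  proof (intro exI conjI allI impI)
    show "0 < e / (K + 1)" using e \<open>K \<ge> 0\<close> by simp
    fix y assume y: "norm (y - x) < e / (K + 1)"
    have "norm (f y - f x - L (y - x)) \<le> (K * norm (y - x)) * norm (y - x)"
      using rem[of "y - x"] by (simp add: power2_eq_square mult.assoc)
    also have "\<dots> \<le> e * norm (y - x)"
    proof (rule mult_right_mono)
      have "K * norm (y - x) \<le> (K + 1) * norm (y - x)" by (simp add: algebra_simps)
      also have "\<dots> \<le> e" using y \<open>K \<ge> 0\<close> by (simp add: field_simps)
      finally show "K * norm (y - x) \<le> e" .
    qed simp
    finally show "norm (f y - f x - L (y - x)) \<le> e * norm (y - x)" .
  qed
qed fact

text \<open>Differentiation under the integral sign. The estimate \<open>\<bar>exp (i t) - 1 - i t\<bar> \<le> t\<^sup>2 / 2\<close> with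
\<open>t = - 2 \<pi> x \<bullet> h\<close>, integrated against \<open>u\<close>, bounds the remainder by a multiple of \<open>\<bar>h\<bar>\<^sup>2\<close>, because
\<open>\<bar>x\<bar>\<^sup>2 u\<close> is integrable.\<close>

lemma fourier_has_derivative:
  fixes u :: "plane \<Rightarrow> complex"
  assumes u: "u \<in> schwartz"
  shows "(fourier u has_derivative
     (\<lambda>h. \<Sum>b\<in>Basis. of_real (h \<bullet> b) * fourier (\<lambda>x. - (2 * \<i> * pi) * (of_real (x \<bullet> b) * u x)) \<xi>)) (at \<xi>)"
proof -
  let ?e = "\<lambda>x. exp (\<i> * of_real (- 2 * pi * (x \<bullet> \<xi>)))"
  let ?v = "\<lambda>b x. - (2 * \<i> * pi) * (of_real (x \<bullet> b) * u x)"
  have v: "?v b \<in> schwartz" for b using u by (intro schwartz_scale schwartz_coord_mult)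
  have int: "integrable lborel (\<lambda>x. ?e x * ?v b x)" for b
    using v[of b] by (intro integrable_phase_mult integrable_schwartz) auto
  have intu: "integrable lborel (\<lambda>x. exp (\<i> * of_real (- 2 * pi * (x \<bullet> \<zeta>))) * u x)" for \<zeta>
    using u by (intro integrable_phase_mult integrable_schwartz) auto
  have int2: "integrable lborel (\<lambda>x. (norm x)\<^sup>2 * norm (u x))"
  proof -
    have "integrable lborel (\<lambda>x. \<Sum>b\<in>Basis. norm (of_real (x \<bullet> b) * (of_real (x \<bullet> b) * u x)))"
      using u by (intro Bochner_Integration.integrable_sum integrable_norm integrable_schwartz schwartz_coord_mult)
    moreover have "(\<Sum>b\<in>Basis. norm (of_real (x \<bullet> b) * (of_real (x \<bullet> b) * u x))) = (norm x)\<^sup>2 * norm (u x)" for x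
      by (simp add: norm_mult power2_norm_eq_inner euclidean_inner[of x x] sum_distrib_right abs_mult_self_eq
            mult.assoc[symmetric])
    ultimately show ?thesis by simp
  qed
  define K where "K = (2 * pi)\<^sup>2 / 2 * (\<integral>x. (norm x)\<^sup>2 * norm (u x) \<partial>lborel)"
  show ?thesis
  proof (rule has_derivative_quadratic_remainder)
    show "bounded_linear (\<lambda>h. \<Sum>b\<in>Basis. of_real (h \<bullet> b) * fourier (?v b) \<xi>)"
      by (intro bounded_linear_sum bounded_linear_mult_const bounded_linear_of_real
          bounded_linear_compose[OF bounded_linear_of_real] bounded_linear_inner_left)
    show "K \<ge> 0" unfolding K_def by (intro mult_nonneg_nonneg integral_nonneg) auto
    fix h :: plane
    let ?r = "\<lambda>x. exp (\<i> * of_real (- 2 * pi * (x \<bullet> (\<xi> + h)))) * u x - ?e x * u x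
        - (\<Sum>b\<in>Basis. of_real (h \<bullet> b) * (?e x * ?v b x))"
    have remainder: "fourier u (\<xi> + h) - fourier u \<xi> - (\<Sum>b\<in>Basis. of_real (h \<bullet> b) * fourier (?v b) \<xi>)
        = (\<integral>x. ?r x \<partial>lborel)"
      unfolding fourier_alt
      by (rule has_bochner_integral_integral_eq[symmetric])
        (intro has_bochner_integral_diff has_bochner_integral_sum has_bochner_integral_mult_right
          has_bochner_integral_integrable int intu)
    have "norm (\<integral>x. ?r x \<partial>lborel) \<le> (\<integral>x. (2 * pi)\<^sup>2 / 2 * (norm h)\<^sup>2 * ((norm x)\<^sup>2 * norm (u x)) \<partial>lborel)"
    proof (rule Bochner_Integration.integral_norm_bound_integral)
      show "integrable lborel ?r"
        by (intro Bochner_Integration.integrable_diff Bochner_Integration.integrable_sum integrable_mult_right int intu)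
      show "integrable lborel (\<lambda>x. (2 * pi)\<^sup>2 / 2 * (norm h)\<^sup>2 * ((norm x)\<^sup>2 * norm (u x)))"
        by (intro integrable_mult_right int2)
      fix x :: plane
      define t where "t = - 2 * pi * (x \<bullet> h)"
      have xh: "x \<bullet> h = (\<Sum>b\<in>Basis. (h \<bullet> b) * (x \<bullet> b))"
        by (simp add: euclidean_inner[of x h] mult.commute)
      have "(\<Sum>b\<in>Basis. of_real (h \<bullet> b) * (?e x * ?v b x))
          = (\<Sum>b\<in>Basis. complex_of_real ((h \<bullet> b) * (x \<bullet> b)) * (- (2 * \<i> * pi) * (?e x * u x)))"
        by (intro sum.cong) (auto simp: mult_ac)
      also have "\<dots> = of_real (x \<bullet> h) * (- (2 * \<i> * pi) * (?e x * u x))"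
        unfolding xh of_real_sum sum_distrib_right ..
      also have "\<dots> = ?e x * u x * (\<i> * t)" by (simp add: t_def mult_ac)
      finally have s: "(\<Sum>b\<in>Basis. of_real (h \<bullet> b) * (?e x * ?v b x)) = ?e x * u x * (\<i> * t)" .
      have "exp (\<i> * of_real (- 2 * pi * (x \<bullet> (\<xi> + h)))) = ?e x * exp (\<i> * t)"
        unfolding t_def exp_add[symmetric] by (simp add: inner_add_right algebra_simps)
      then have "?r x = ?e x * u x * (exp (\<i> * t) - (1 + \<i> * t))"
        unfolding s by (simp add: algebra_simps)
      then have "norm (?r x) = norm (u x) * norm (exp (\<i> * t) - (1 + \<i> * t))"
        by (simp only: norm_mult norm_exp_i_times mult_1)
      also have "\<dots> \<le> norm (u x) * (t\<^sup>2 / 2)"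
        using iexp_approx1[of t 1] by (intro mult_left_mono) (auto simp: power2_eq_square numeral_2_eq_2)
      also have "\<dots> \<le> norm (u x) * ((2 * pi * (norm x * norm h))\<^sup>2 / 2)"
      proof -
        have "\<bar>t\<bar> \<le> \<bar>2 * pi * (norm x * norm h)\<bar>"
          unfolding t_def by (auto simp: abs_mult intro!: Cauchy_Schwarz_ineq2)
        then have "t\<^sup>2 \<le> (2 * pi * (norm x * norm h))\<^sup>2" by (simp only: abs_le_square_iff)
        then show ?thesis by (intro mult_left_mono divide_right_mono) auto
      qed
      also have "\<dots> = (2 * pi)\<^sup>2 / 2 * (norm h)\<^sup>2 * ((norm x)\<^sup>2 * norm (u x))"
        by (simp add: power_mult_distrib)
      finally show "norm (?r x) \<le> (2 * pi)\<^sup>2 / 2 * (norm h)\<^sup>2 * ((norm x)\<^sup>2 * norm (u x))" .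
    qed
    also have "\<dots> = K * (norm h)\<^sup>2"
      unfolding K_def integral_mult_right_zero by (simp only: mult_ac)
    finally show "norm (fourier u (\<xi> + h) - fourier u \<xi> - (\<Sum>b\<in>Basis. of_real (h \<bullet> b) * fourier (?v b) \<xi>))
        \<le> K * (norm h)\<^sup>2" unfolding remainder .
  qed
qed

lemma partial_deriv_fourier:
  fixes u :: "plane \<Rightarrow> complex"
  assumes "u \<in> schwartz" "b \<in> Basis"
  shows "partial_deriv b (fourier u) = fourier (\<lambda>x. - (2 * \<i> * pi) * (of_real (x \<bullet> b) * u x))"
proof
  fix \<xi>
  have "(\<Sum>b'\<in>Basis. complex_of_real (b \<bullet> b') * fourier (\<lambda>x. - (2 * \<i> * pi) * (of_real (x \<bullet> b') * u x)) \<xi>)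
    = (\<Sum>b'\<in>Basis. if b' = b then fourier (\<lambda>x. - (2 * \<i> * pi) * (of_real (x \<bullet> b') * u x)) \<xi> else 0)"
    using assms(2) by (intro sum.cong) (auto simp: inner_Basis)
  with partial_deriv_eq[OF fourier_has_derivative[OF assms(1)], of b \<xi>]
  show "partial_deriv b (fourier u) \<xi> = fourier (\<lambda>x. - (2 * \<i> * pi) * (of_real (x \<bullet> b) * u x)) \<xi>"
    using assms(2) by simp
qed

text \<open>The set of all Fourier transforms is a stable family, because a derivative of a Fourier transform
is the transform of a coordinate multiple. For the decay, each power of \<open>\<bar>\<xi>\<bar>\<close> is bounded by the sum
of the coordinates of \<open>\<xi>\<close>, and a coordinate is absorbed as a derivative of the original function.\<close>

lemma schwartz_fourier:
  fixes u :: "plane \<Rightarrow> complex"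
  assumes "u \<in> schwartz"
  shows "fourier u \<in> schwartz"
proof (rule schwartz_coinduct[where X = "fourier ` schwartz"])
  fix g :: "plane \<Rightarrow> complex" and b :: plane assume "g \<in> fourier ` schwartz" "b \<in> Basis"
  then show "partial_deriv b g \<in> fourier ` schwartz"
    by (auto simp only: partial_deriv_fourier intro!: imageI schwartz_scale schwartz_coord_mult)
next
  fix g :: "plane \<Rightarrow> complex" and x assume "g \<in> fourier ` schwartz"
  then show "g differentiable at x" using fourier_has_derivative unfolding differentiable_def by blast
next
  fix g :: "plane \<Rightarrow> complex" and k assume "g \<in> fourier ` schwartz"
  then obtain u where u: "g = fourier u" "u \<in> schwartz" by blast
  have "\<exists>C. \<forall>\<xi>. norm \<xi> ^ k * norm (fourier u \<xi>) \<le> C" using u(2)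
  proof (induction k arbitrary: u)
    case 0
    then show ?case using fourier_bounded[of u] by auto
  next
    case (Suc k)
    have "\<exists>C. \<forall>\<xi>. norm \<xi> ^ k * norm (fourier (partial_deriv b u) \<xi>) \<le> C" if "b \<in> Basis" for b
      using Suc.IH[OF schwartz_partial_deriv[OF Suc.prems that]] .
    then obtain C where C: "norm \<xi> ^ k * norm (fourier (partial_deriv b u) \<xi>) \<le> C b" if "b \<in> Basis" for b \<xi>
      by metis
    have "norm \<xi> ^ Suc k * norm (fourier u \<xi>) \<le> (\<Sum>b\<in>Basis. C b)" for \<xi>
    proof -
      have "norm \<xi> ^ Suc k * norm (fourier u \<xi>) = norm \<xi> ^ k * norm (fourier u \<xi>) * norm \<xi>" by simp
      also have "\<dots> \<le> norm \<xi> ^ k * norm (fourier u \<xi>) * (\<Sum>b\<in>Basis. \<bar>\<xi> \<bullet> b\<bar>)"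
        by (intro mult_left_mono norm_le_l1) auto
      also have "\<dots> = (\<Sum>b\<in>Basis. norm \<xi> ^ k * (\<bar>\<xi> \<bullet> b\<bar> * norm (fourier u \<xi>)))"
        by (simp add: sum_distrib_left mult_ac)
      also have "\<dots> \<le> (\<Sum>b\<in>Basis. norm \<xi> ^ k * norm (fourier (partial_deriv b u) \<xi>))"
      proof (intro sum_mono mult_left_mono)
        fix b :: plane assume b: "b \<in> Basis"
        have "1 * (\<bar>\<xi> \<bullet> b\<bar> * norm (fourier u \<xi>)) \<le> (2 * pi) * (\<bar>\<xi> \<bullet> b\<bar> * norm (fourier u \<xi>))"
          using pi_gt3 by (intro mult_right_mono) auto
        then show "\<bar>\<xi> \<bullet> b\<bar> * norm (fourier u \<xi>) \<le> norm (fourier (partial_deriv b u) \<xi>)"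
          using fourier_partial_deriv[OF Suc.prems b, of \<xi>] by (simp add: norm_mult)
      qed auto
      also have "\<dots> \<le> (\<Sum>b\<in>Basis. C b)" by (intro sum_mono C)
      finally show ?thesis .
    qed
    then show ?case by blast
  qed
  then show "\<exists>C. \<forall>x. norm x ^ k * norm (g x) \<le> C" using u by simp
qed (use assms in auto)

section \<open>The Gaussian and Fourier inversion\<close>

lemma integral_scaling:
  fixes f :: "'a::euclidean_space \<Rightarrow> complex"
  assumes [measurable]: "f \<in> borel_measurable borel" and c: "\<And>b. b \<in> Basis \<Longrightarrow> c b \<noteq> 0"
  shows "(\<integral>x. f x \<partial>lborel)
    = of_real (\<Prod>b\<in>Basis. \<bar>c b\<bar>) * (\<integral>x. f (t + (\<Sum>b\<in>Basis. (c b * (x \<bullet> b)) *\<^sub>R b)) \<partial>lborel)"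
proof -
  have "integral\<^sup>L lborel f = integral\<^sup>L (density (distr lborel borel (\<lambda>x. t + (\<Sum>b\<in>Basis. (c b * (x \<bullet> b)) *\<^sub>R b)))
      (\<lambda>_. ennreal (\<Prod>b\<in>Basis. \<bar>c b\<bar>))) f"
    using lborel_affine_euclidean[of c t] c by (simp add: prod_ennreal)
  also have "\<dots> = of_real (\<Prod>b\<in>Basis. \<bar>c b\<bar>) * (\<integral>x. f (t + (\<Sum>b\<in>Basis. (c b * (x \<bullet> b)) *\<^sub>R b)) \<partial>lborel)"
    by (subst integral_density) (auto simp: prod_nonneg integral_distr scaleR_conv_of_real)
  finally show ?thesis .
qed

lemma integral_plane_scaling:
  fixes f :: "plane \<Rightarrow> complex"
  assumes "f \<in> borel_measurable borel" "a \<noteq> 0" "b \<noteq> 0"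
  shows "(\<integral>x. f x \<partial>lborel) = of_real \<bar>a * b\<bar> * (\<integral>x. f (t + (a * fst x, b * snd x)) \<partial>lborel)"
proof -
  have [simp]: "Basis = {(1, 0), (0, 1 :: real) :: plane}" by (rule Basis_plane)
  show ?thesis
    using integral_scaling[OF assms(1), of "\<lambda>e. if e = (1, 0) then a else b" t] assms(2,3)
    by (auto simp: abs_mult inner_prod_def)
qed

text \<open>The Gaussian of variance \<open>1 / (2 \<pi>)\<close> is the standard normal density rescaled by \<open>sqrt (2 \<pi>)\<close>, so
its transform is read off from the characteristic function of the normal distribution.\<close>

lemma gaussian_line:
  shows "integrable lborel (\<lambda>t. complex_of_real (exp (- pi * t\<^sup>2)))"
    and "(\<integral>t. exp (\<i> * of_real (- 2 * pi * (t * s))) * complex_of_real (exp (- pi * t\<^sup>2)) \<partial>lborel)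
      = of_real (exp (- pi * s\<^sup>2))"
proof -
  define c where "c = sqrt (2 * pi)"
  have c: "c > 0" "c\<^sup>2 = 2 * pi" by (simp_all add: c_def)
  have g: "c * std_normal_density (c * t) = exp (- pi * t\<^sup>2)" for t
    using c unfolding std_normal_density_def c_def[symmetric] by (simp add: power_mult_distrib)
  have "integrable lborel (\<lambda>t. c * std_normal_density (0 + c * t))"
    using c by (intro integrable_mult_right lborel_integrable_real_affine integrable_normal_density) auto
  then have "integrable lborel (\<lambda>t. exp (- pi * t\<^sup>2))" by (simp add: g)
  then show "integrable lborel (\<lambda>t. complex_of_real (exp (- pi * t\<^sup>2)))" by (rule integrable_of_real)
  define r where "r = - 2 * pi * s / c"
  have r: "r\<^sup>2 / 2 = pi * s\<^sup>2" "r * (c * t) = - 2 * pi * (t * s)" for t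
    using c by (simp_all add: r_def power_divide power_mult_distrib) (simp add: power2_eq_square)
  have "char std_normal_distribution r = (\<integral>x. std_normal_density x *\<^sub>R exp (\<i> * of_real (r * x)) \<partial>lborel)"
    unfolding char_def by (subst integral_density) auto
  also have "\<dots> = \<bar>c\<bar> *\<^sub>R (\<integral>t. std_normal_density (0 + c * t) *\<^sub>R exp (\<i> * of_real (r * (0 + c * t))) \<partial>lborel)"
    using c by (intro lborel_integral_real_affine) auto
  also have "\<dots> = (\<integral>t. c *\<^sub>R (std_normal_density (c * t) *\<^sub>R exp (\<i> * of_real (r * (c * t)))) \<partial>lborel)"
    using c by (simp del: scaleR_scaleR)
  also have "\<dots> = (\<integral>t. exp (\<i> * of_real (- 2 * pi * (t * s))) * complex_of_real (exp (- pi * t\<^sup>2)) \<partial>lborel)"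
    unfolding scaleR_scaleR g r unfolding scaleR_conv_of_real by (simp only: mult.commute)
  finally show "(\<integral>t. exp (\<i> * of_real (- 2 * pi * (t * s))) * complex_of_real (exp (- pi * t\<^sup>2)) \<partial>lborel)
      = of_real (exp (- pi * s\<^sup>2))"
    using r(1) by (simp add: char_std_normal_distribution)
qed

text \<open>The normalization for which the Gaussian is a fixed point of the Fourier transform.\<close>

definition gaussian :: "plane \<Rightarrow> complex" where
  "gaussian x = of_real (exp (- pi * (norm x)\<^sup>2))"

lemma gaussian_tensor:
  "gaussian x = of_real (exp (- pi * (fst x)\<^sup>2)) * of_real (exp (- pi * (snd x)\<^sup>2))"
  unfolding gaussian_def of_real_mult[symmetric] exp_add[symmetric]
  by (simp add: norm_prod_def algebra_simps)

lemma integrable_gaussian: "integrable lborel gaussian"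
  using tensor_integral(1)[OF gaussian_line(1) gaussian_line(1)] by (simp add: gaussian_tensor[abs_def])

lemma fourier_gaussian: "fourier gaussian = gaussian"
proof
  fix \<xi> :: plane
  let ?g = "\<lambda>s t. exp (\<i> * of_real (- 2 * pi * (t * s))) * complex_of_real (exp (- pi * t\<^sup>2))"
  have int: "integrable lborel (?g s)" for s
    by (intro integrable_phase_mult gaussian_line(1)) simp
  have "fourier gaussian \<xi> = (\<integral>x. ?g (fst \<xi>) (fst x) * ?g (snd \<xi>) (snd x) \<partial>lborel)"
    unfolding fourier_alt
  proof (intro Bochner_Integration.integral_cong refl)
    fix x :: plane
    have "exp (\<i> * of_real (- 2 * pi * (x \<bullet> \<xi>)))
      = exp (\<i> * of_real (- 2 * pi * (fst x * fst \<xi>))) * exp (\<i> * of_real (- 2 * pi * (snd x * snd \<xi>)))"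
      unfolding exp_add[symmetric] by (simp add: inner_prod_def algebra_simps)
    then show "exp (\<i> * of_real (- 2 * pi * (x \<bullet> \<xi>))) * gaussian x = ?g (fst \<xi>) (fst x) * ?g (snd \<xi>) (snd x)"
      by (simp only: gaussian_tensor mult_ac)
  qed
  also have "\<dots> = gaussian \<xi>"
    unfolding tensor_integral(2)[OF int int] gaussian_line(2) gaussian_tensor ..
  finally show "fourier gaussian \<xi> = gaussian \<xi>" .
qed

lemma integral_gaussian: "(\<integral>x. gaussian x \<partial>lborel) = 1"
  using fun_cong[OF fourier_gaussian, of 0] by (simp add: fourier_alt gaussian_def)

lemma norm_gaussian_le: "norm (gaussian x) \<le> 1"
  by (simp add: gaussian_def)

lemma continuous_gaussian: "continuous_on UNIV gaussian"
  unfolding gaussian_def by (intro continuous_intros)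

text \<open>Both sides are the double integral of \<open>exp (- 2 i \<pi> x \<bullet> y) a(y) b(x)\<close>.\<close>

lemma fourier_multiplication_formula:
  fixes a b :: "'a::euclidean_space \<Rightarrow> complex"
  assumes "integrable lborel a" "integrable lborel b"
  shows "(\<integral>x. fourier a x * b x \<partial>lborel) = (\<integral>y. a y * fourier b y \<partial>lborel)"
proof -
  have [measurable]: "a \<in> borel_measurable borel" "b \<in> borel_measurable borel"
    using borel_measurable_integrable[OF assms(1)] borel_measurable_integrable[OF assms(2)] by simp_all
  let ?F = "\<lambda>x y. exp (\<i> * of_real (- 2 * pi * (y \<bullet> x))) * a y * b x"
  have "integrable lborel (\<lambda>y. ?F x y)" for x
    by (intro integrable_mult_left integrable_phase_mult assms) measurable
  moreover have "integrable lborel (\<lambda>x. \<integral>y. norm (?F x y) \<partial>lborel)"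
    using assms by (simp add: norm_mult)
  ultimately have "integrable (lborel \<Otimes>\<^sub>M lborel) (\<lambda>(x, y). ?F x y)"
    by (intro lborel_pair.Fubini_integrable) auto
  from lborel_pair.Fubini_integral[OF this]
  have "(\<integral>y. \<integral>x. ?F x y \<partial>lborel \<partial>lborel) = (\<integral>x. \<integral>y. ?F x y \<partial>lborel \<partial>lborel)" .
  moreover have "(\<integral>x. ?F x y \<partial>lborel) = a y * fourier b y" for y
    unfolding fourier_alt by (subst integral_mult_right_zero[symmetric]) (simp only: mult_ac inner_commute)
  moreover have "(\<integral>y. ?F x y \<partial>lborel) = fourier a x * b x" for x
    unfolding fourier_alt by simp
  ultimately show ?thesis by (simp only:)
qed

text \<open>For \<open>r > 0\<close>, the multiplication formula for \<open>z \<mapsto> u (x + r z)\<close> and the Gaussian \<open>G\<close> becomes, after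
rescaling,
\<open>\<integral> exp (2 i \<pi> x \<bullet> \<zeta>) (fourier u \<zeta>) G (r \<zeta>) d\<zeta> = \<integral> u (x + r z) G z dz\<close>.
As \<open>r\<close> tends to 0, dominated convergence turns the left side into the inversion integral and the
right side into \<open>u x\<close>.\<close>

lemma fourier_inversion:
  fixes u :: "plane \<Rightarrow> complex"
  assumes u: "integrable lborel u" and cont: "continuous_on UNIV u" and bdd: "\<And>x. norm (u x) \<le> C"
    and Fu: "integrable lborel (fourier u)"
  shows "fourier (fourier u) (- x) = u x"
proof -
  have [measurable]: "u \<in> borel_measurable borel" "fourier u \<in> borel_measurable borel"
      "gaussian \<in> borel_measurable borel"
    using cont borel_measurable_integrable[OF Fu] continuous_gaussian
    by (simp_all add: borel_measurable_continuous_onI)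
  define e where "e n = inverse (real (Suc n))" for n
  have e: "e n > 0" for n by (simp add: e_def)
  have e0: "e \<longlonglongrightarrow> 0" unfolding e_def by (rule LIMSEQ_inverse_real_of_nat)
  let ?E = "\<lambda>\<zeta>. exp (\<i> * of_real (2 * pi * (x \<bullet> \<zeta>)))"
  have key: "(\<integral>\<zeta>. ?E \<zeta> * fourier u \<zeta> * gaussian (r *\<^sub>R \<zeta>) \<partial>lborel) = (\<integral>z. u (x + r *\<^sub>R z) * gaussian z \<partial>lborel)"
    if r: "r > 0" for r
  proof -
    define v where "v z = u (x + r *\<^sub>R z)" for z
    have scaling: "(\<integral>z. f z \<partial>lborel) = of_real (r\<^sup>2) * (\<integral>z. f (t + r *\<^sub>R z) \<partial>lborel)"
      if "f \<in> borel_measurable borel" for f :: "plane \<Rightarrow> complex" and t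
      using integral_plane_scaling[OF that, of r r t] r
      by (simp add: scaleR_prod_def power2_eq_square)
    have v: "integrable lborel v"
    proof -
      define k where "k = \<bar>r\<bar> ^ DIM(plane)"
      have k: "k > 0" using r by (simp add: k_def)
      have "lborel = density (distr lborel borel (\<lambda>z. x + r *\<^sub>R z)) (\<lambda>_. ennreal k)"
        using lborel_affine[of r x] r by (simp add: k_def)
      then have "integrable (density (distr lborel borel (\<lambda>z. x + r *\<^sub>R z)) (\<lambda>_. ennreal k)) u"
        using u by metis
      then have "integrable lborel (\<lambda>z. k *\<^sub>R v z)"
        using k unfolding v_def by (subst (asm) integrable_density) (auto simp: integrable_distr_eq)
      then have "integrable lborel (\<lambda>z. inverse k *\<^sub>R k *\<^sub>R v z)"
        by (rule integrable_scaleR_right)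
      then show ?thesis using k by simp
    qed
    \<comment> \<open>The factor \<open>r\<^sup>2\<close> is the Jacobian of \<open>z \<mapsto> x + r z\<close> in the plane.\<close>
    have Fv: "of_real (r\<^sup>2) * fourier v (r *\<^sub>R \<zeta>) = ?E \<zeta> * fourier u \<zeta>" for \<zeta>
    proof -
      have "fourier u \<zeta> = (\<integral>y. exp (\<i> * of_real (- 2 * pi * (y \<bullet> \<zeta>))) * u y \<partial>lborel)" by (rule fourier_alt)
      also have "\<dots> = of_real (r\<^sup>2) * (\<integral>z. exp (\<i> * of_real (- 2 * pi * ((x + r *\<^sub>R z) \<bullet> \<zeta>))) * u (x + r *\<^sub>R z) \<partial>lborel)"
        by (rule scaling) measurable
      finally have shift: "?E \<zeta> * fourier u \<zeta> = of_real (r\<^sup>2) *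
        (\<integral>z. ?E \<zeta> * (exp (\<i> * of_real (- 2 * pi * ((x + r *\<^sub>R z) \<bullet> \<zeta>))) * u (x + r *\<^sub>R z)) \<partial>lborel)"
        by simp
      have "?E \<zeta> * (exp (\<i> * of_real (- 2 * pi * ((x + r *\<^sub>R z) \<bullet> \<zeta>))) * u (x + r *\<^sub>R z))
          = exp (\<i> * of_real (- 2 * pi * (z \<bullet> (r *\<^sub>R \<zeta>)))) * v z" for z
        unfolding v_def mult.assoc[symmetric] exp_add[symmetric]
        by (simp add: inner_add_left algebra_simps)
      then show ?thesis unfolding shift fourier_alt[of v] by (simp only:)
    qed
    have [measurable]: "fourier v \<in> borel_measurable borel"
    proof -
      have "fourier v = (\<lambda>\<zeta>. ?E ((1 / r) *\<^sub>R \<zeta>) * fourier u ((1 / r) *\<^sub>R \<zeta>) / of_real (r\<^sup>2))"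
      proof
        fix \<zeta>
        show "fourier v \<zeta> = ?E ((1 / r) *\<^sub>R \<zeta>) * fourier u ((1 / r) *\<^sub>R \<zeta>) / of_real (r\<^sup>2)"
          unfolding Fv[symmetric] using r by simp
      qed
      also have "\<dots> \<in> borel_measurable borel" by measurable
      finally show ?thesis .
    qed
    have "(\<integral>z. v z * gaussian z \<partial>lborel) = (\<integral>\<xi>. fourier v \<xi> * gaussian \<xi> \<partial>lborel)"
      using fourier_multiplication_formula[OF v integrable_gaussian] by (simp add: fourier_gaussian)
    also have "\<dots> = of_real (r\<^sup>2) * (\<integral>\<zeta>. fourier v (0 + r *\<^sub>R \<zeta>) * gaussian (0 + r *\<^sub>R \<zeta>) \<partial>lborel)"
      by (rule scaling) measurable
    also have "\<dots> = (\<integral>\<zeta>. ?E \<zeta> * fourier u \<zeta> * gaussian (r *\<^sub>R \<zeta>) \<partial>lborel)"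
      unfolding Fv[symmetric] by (subst integral_mult_right_zero[symmetric]) (simp add: mult.assoc)
    finally show ?thesis by (simp add: v_def)
  qed
  have "(\<lambda>n. \<integral>z. u (x + e n *\<^sub>R z) * gaussian z \<partial>lborel) \<longlonglongrightarrow> (\<integral>z. u x * gaussian z \<partial>lborel)"
  proof (rule integral_dominated_convergence)
    show "integrable lborel (\<lambda>z. C * norm (gaussian z))"
      using integrable_gaussian by (intro integrable_mult_right integrable_norm)
    show "AE z in lborel. (\<lambda>n. u (x + e n *\<^sub>R z) * gaussian z) \<longlonglongrightarrow> u x * gaussian z"
    proof (intro AE_I2 tendsto_mult tendsto_const)
      fix z
      have "(\<lambda>n. x + e n *\<^sub>R z) \<longlonglongrightarrow> x + 0 *\<^sub>R z" by (intro tendsto_intros e0)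
      then have "(\<lambda>n. x + e n *\<^sub>R z) \<longlonglongrightarrow> x" by simp
      moreover have "isCont u x" using cont continuous_on_eq_continuous_at by blast
      ultimately show "(\<lambda>n. u (x + e n *\<^sub>R z)) \<longlonglongrightarrow> u x" by (rule isCont_tendsto_compose[rotated])
    qed
    show "AE z in lborel. norm (u (x + e n *\<^sub>R z) * gaussian z) \<le> C * norm (gaussian z)" for n
      using bdd by (intro AE_I2) (simp add: norm_mult mult_right_mono)
  qed measurable
  moreover have "(\<lambda>n. \<integral>\<zeta>. ?E \<zeta> * fourier u \<zeta> * gaussian (e n *\<^sub>R \<zeta>) \<partial>lborel)
      \<longlonglongrightarrow> (\<integral>\<zeta>. ?E \<zeta> * fourier u \<zeta> * gaussian (0 *\<^sub>R \<zeta>) \<partial>lborel)"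
  proof (rule integral_dominated_convergence)
    show "integrable lborel (\<lambda>\<zeta>. norm (fourier u \<zeta>))" using Fu by (rule integrable_norm)
    show "AE \<zeta> in lborel. (\<lambda>n. ?E \<zeta> * fourier u \<zeta> * gaussian (e n *\<^sub>R \<zeta>))
        \<longlonglongrightarrow> ?E \<zeta> * fourier u \<zeta> * gaussian (0 *\<^sub>R \<zeta>)"
    proof (intro AE_I2 tendsto_mult tendsto_const)
      fix \<zeta> :: plane
      have "isCont gaussian (0 *\<^sub>R \<zeta>)" using continuous_gaussian continuous_on_eq_continuous_at by blast
      then show "(\<lambda>n. gaussian (e n *\<^sub>R \<zeta>)) \<longlonglongrightarrow> gaussian (0 *\<^sub>R \<zeta>)"
        by (rule isCont_tendsto_compose) (intro tendsto_intros e0)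
    qed
    show "AE \<zeta> in lborel. norm (?E \<zeta> * fourier u \<zeta> * gaussian (e n *\<^sub>R \<zeta>)) \<le> norm (fourier u \<zeta>)" for n
      using norm_gaussian_le by (intro AE_I2) (simp only: norm_mult norm_exp_i_times mult_1 mult_left_le norm_ge_zero)
  qed measurable
  ultimately have "(\<integral>\<zeta>. ?E \<zeta> * fourier u \<zeta> * gaussian (0 *\<^sub>R \<zeta>) \<partial>lborel) = (\<integral>z. u x * gaussian z \<partial>lborel)"
    unfolding key[OF e] by (rule LIMSEQ_unique[rotated])
  then have "(\<integral>\<zeta>. ?E \<zeta> * fourier u \<zeta> \<partial>lborel) = u x"
    by (simp add: integral_gaussian) (simp add: gaussian_def)
  then show ?thesis by (simp add: fourier_alt[of "fourier u"] inner_commute)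
qed


definition inverse_fourier :: "('a::euclidean_space \<Rightarrow> complex) \<Rightarrow> 'a \<Rightarrow> complex" where
  "inverse_fourier u x = fourier u (- x)"

lemma schwartz_reflect:
  fixes u :: "'a::euclidean_space \<Rightarrow> complex"
  shows "u \<in> schwartz \<Longrightarrow> (\<lambda>x. u (- x)) \<in> schwartz"
  by (rule schwartz_comp_linear[where A = uminus and K = 1]) (auto intro: bounded_linear_minus bounded_linear_ident)

lemma schwartz_inverse_fourier:
  fixes u :: "plane \<Rightarrow> complex"
  shows "u \<in> schwartz \<Longrightarrow> inverse_fourier u \<in> schwartz"
  using schwartz_reflect[OF schwartz_fourier] by (simp add: inverse_fourier_def[abs_def])

lemma inverse_fourier_fourier:
  fixes u :: "plane \<Rightarrow> complex"
  assumes "u \<in> schwartz"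
  shows "inverse_fourier (fourier u) = u"
proof
  fix x
  obtain C where "\<And>x. norm (u x) \<le> C" using schwartz_bounded[OF assms] by blast
  then show "inverse_fourier (fourier u) x = u x"
    unfolding inverse_fourier_def
    using assms by (intro fourier_inversion integrable_schwartz schwartz_fourier schwartz_continuous)
qed

lemma fourier_reflect: "fourier (\<lambda>x. u (- x)) \<xi> = fourier u (- \<xi>)" if "u \<in> schwartz" for u :: "plane \<Rightarrow> complex"
proof -
  have [measurable]: "u \<in> borel_measurable borel" using that by (rule schwartz_measurable)
  have "fourier u (- \<xi>) = of_real \<bar>(- 1) * (- 1)\<bar> * (\<integral>x. exp (\<i> * of_real (- 2 * pi * ((0 + (- 1 * fst x, - 1 * snd x)) \<bullet> (- \<xi>))))
     * u (0 + (- 1 * fst x, - 1 * snd x)) \<partial>lborel)"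
    unfolding fourier_alt by (rule integral_plane_scaling) auto
  also have "\<dots> = fourier (\<lambda>x. u (- x)) \<xi>"
    unfolding fourier_alt by (simp add: uminus_prod_def inner_prod_def)
  finally show ?thesis by simp
qed

lemma fourier_inverse_fourier:
  fixes u :: "plane \<Rightarrow> complex"
  assumes "u \<in> schwartz"
  shows "fourier (inverse_fourier u) = u"
proof
  fix x
  have "fourier (inverse_fourier u) x = fourier (fourier u) (- x)"
    unfolding inverse_fourier_def[abs_def] by (rule fourier_reflect[OF schwartz_fourier[OF assms]])
  also have "\<dots> = u x" using fun_cong[OF inverse_fourier_fourier[OF assms], of x] by (simp add: inverse_fourier_def)
  finally show "fourier (inverse_fourier u) x = u x" .
qed

text \<open>The multiplication formula for \<open>u\<close> and the complex conjugate of \<open>v\<close>; conjugation replaces the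
Fourier transform by its inverse.\<close>

lemma l2_inner_fourier:
  fixes u v :: "plane \<Rightarrow> complex"
  assumes "u \<in> schwartz" "v \<in> schwartz"
  shows "l2_inner (fourier u) v = l2_inner u (inverse_fourier v)"
proof -
  have "fourier (\<lambda>x. cnj (v x)) y = cnj (inverse_fourier v y)" for y
    unfolding fourier_alt inverse_fourier_def Bochner_Integration.integral_cnj[symmetric]
    by (simp add: exp_cnj del: Bochner_Integration.integral_cnj)
  then show ?thesis
    unfolding l2_inner_def
    using fourier_multiplication_formula[of u "\<lambda>x. cnj (v x)"] assms integrable_schwartz by auto
qed

section \<open>Unitary maps of the Schwartz space\<close>

lemma unitary_on_schwartzI:
  assumes "\<And>u. u \<in> schwartz \<Longrightarrow> T u \<in> schwartz" "\<And>u. u \<in> schwartz \<Longrightarrow> T' u \<in> schwartz"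
    and "\<And>u. u \<in> schwartz \<Longrightarrow> T' (T u) = u" "\<And>u. u \<in> schwartz \<Longrightarrow> T (T' u) = u"
    and "\<And>u v. u \<in> schwartz \<Longrightarrow> v \<in> schwartz \<Longrightarrow> l2_inner (T u) (T v) = l2_inner u v"
  shows "unitary_on_schwartz T"
  unfolding unitary_on_schwartz_def using assms by (auto intro: bij_betwI[where g = T'])

lemma unitary_on_schwartz_compose:
  assumes "unitary_on_schwartz S" "unitary_on_schwartz T"
  shows "unitary_on_schwartz (\<lambda>u. S (T u))"
  using assms bij_betw_trans[of T schwartz schwartz S schwartz]
  unfolding unitary_on_schwartz_def by (auto simp: comp_def bij_betwE)

lemma unitary_on_schwartz_maps: "unitary_on_schwartz T \<Longrightarrow> u \<in> schwartz \<Longrightarrow> T u \<in> schwartz"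
  unfolding unitary_on_schwartz_def by (auto simp: bij_betwE)

lemma unitary_fourier: "unitary_on_schwartz (fourier :: (plane \<Rightarrow> complex) \<Rightarrow> _)"
  by (rule unitary_on_schwartzI[where T' = inverse_fourier])
    (auto simp: schwartz_fourier schwartz_inverse_fourier inverse_fourier_fourier fourier_inverse_fourier l2_inner_fourier)

lemma unitary_inverse_fourier: "unitary_on_schwartz (inverse_fourier :: (plane \<Rightarrow> complex) \<Rightarrow> _)"
proof (rule unitary_on_schwartzI[where T' = fourier])
  fix u v :: "plane \<Rightarrow> complex" assume uv: "u \<in> schwartz" "v \<in> schwartz"
  have "l2_inner (inverse_fourier u) (inverse_fourier v) = l2_inner (fourier (inverse_fourier u)) v"
    using uv by (simp add: l2_inner_fourier schwartz_inverse_fourier)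
  then show "l2_inner (inverse_fourier u) (inverse_fourier v) = l2_inner u v"
    using uv by (simp add: fourier_inverse_fourier)
qed (auto simp: schwartz_fourier schwartz_inverse_fourier inverse_fourier_fourier fourier_inverse_fourier)

text \<open>Both the phase factor in front of the dilation in \<open>M\<close> and the multiplier
\<open>exp (2 i \<pi> \<eta>\<^sub>1 \<eta>\<^sub>2 / d)\<close> on the Fourier side are of this form.\<close>

definition chirp :: "real \<Rightarrow> (plane \<Rightarrow> complex) \<Rightarrow> plane \<Rightarrow> complex" where
  "chirp \<theta> u x = exp (\<i> * of_real (2 * pi * \<theta> * (fst x * snd x))) * u x"

lemma chirp_phase_has_derivative:
  "((\<lambda>x. 2 * pi * \<theta> * (fst x * snd x)) has_derivative
     (\<lambda>h. 2 * pi * \<theta> * (fst h * snd x + fst x * snd h))) (at (x::plane))"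
  by (auto intro!: derivative_eq_intros simp: algebra_simps)

lemma schwartz_chirp:
  assumes "u \<in> schwartz"
  shows "chirp \<theta> u \<in> schwartz"
  unfolding chirp_def[abs_def]
proof (rule schwartz_unimodular_mult[OF assms chirp_phase_has_derivative])
  fix b :: plane and g :: "plane \<Rightarrow> complex" assume g: "g \<in> schwartz"
  have "(\<lambda>x. of_real (2 * pi * \<theta>) * (of_real (x \<bullet> (snd b, fst b)) * g x)) \<in> schwartz"
    by (intro schwartz_scale schwartz_coord_mult g)
  then show "(\<lambda>x. of_real (2 * pi * \<theta> * (fst b * snd x + fst x * snd b)) * g x) \<in> schwartz"
    by (simp add: inner_prod_def algebra_simps)
qed

lemma unitary_chirp: "unitary_on_schwartz (chirp \<theta>)"
proof (rule unitary_on_schwartzI[where T' = "chirp (- \<theta>)"])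
  fix u v :: "plane \<Rightarrow> complex"
  show "chirp (- \<theta>) (chirp \<theta> u) = u" "chirp \<theta> (chirp (- \<theta>) u) = u"
    by (auto simp: chirp_def[abs_def] mult.assoc[symmetric] exp_add[symmetric])
  have "chirp \<theta> u x * cnj (chirp \<theta> v x) = u x * cnj (v x)" for x
  proof -
    have "chirp \<theta> u x * cnj (chirp \<theta> v x) = (exp (\<i> * of_real (2 * pi * \<theta> * (fst x * snd x)))
       * exp (- (\<i> * of_real (2 * pi * \<theta> * (fst x * snd x))))) * (u x * cnj (v x))"
      by (simp add: chirp_def exp_cnj mult_ac)
    then show ?thesis unfolding exp_add[symmetric] by simp
  qed
  then show "l2_inner (chirp \<theta> u) (chirp \<theta> v) = l2_inner u v" by (simp add: l2_inner_def)
qed (simp_all add: schwartz_chirp)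

text \<open>The factor \<open>(a b) powr (- 1 / 2)\<close> compensates the Jacobian \<open>a b\<close> of the change of variables.\<close>

definition dilate :: "real \<Rightarrow> real \<Rightarrow> (plane \<Rightarrow> complex) \<Rightarrow> plane \<Rightarrow> complex" where
  "dilate a b u x = of_real ((a * b) powr (- 1 / 2)) * u (fst x / a, snd x / b)"

lemma bounded_linear_plane_scaling: "bounded_linear (\<lambda>x::plane. (fst x / a, snd x / b))"
  by (intro bounded_linear_Pair bounded_linear_compose[OF bounded_linear_divide] bounded_linear_fst bounded_linear_snd)

lemma schwartz_dilate:
  assumes "u \<in> schwartz" "a > 0" "b > 0"
  shows "dilate a b u \<in> schwartz"
proof -
  have "(\<lambda>x. u (fst x / a, snd x / b)) \<in> schwartz"
  proof (rule schwartz_comp_linear[OF assms(1) bounded_linear_plane_scaling])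
    fix x :: plane
    let ?y = "(fst x / a, snd x / b)"
    have "norm x \<le> \<bar>fst x\<bar> + \<bar>snd x\<bar>" using norm_Pair_le[of "fst x" "snd x"] by simp
    also have "\<dots> = a * \<bar>fst ?y\<bar> + b * \<bar>snd ?y\<bar>" using assms by simp
    also have "\<dots> \<le> a * norm ?y + b * norm ?y"
      using assms norm_fst_le[of "fst ?y" "snd ?y"] norm_snd_le[of "snd ?y" "fst ?y"]
      by (intro add_mono mult_left_mono) auto
    finally show "norm x \<le> (a + b) * norm ?y" by (simp add: distrib_right)
  qed (use assms in auto)
  then show ?thesis unfolding dilate_def[abs_def] by (rule schwartz_scale)
qed

lemma dilate_inverse:
  assumes "a > 0" "b > 0"
  shows "dilate (1 / a) (1 / b) (dilate a b u) = u" "dilate a b (dilate (1 / a) (1 / b) u) = u"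
proof -
  define k k' where "k = complex_of_real ((a * b) powr (- 1 / 2))"
    and "k' = complex_of_real ((1 / a * (1 / b)) powr (- 1 / 2))"
  have "(1 / a * (1 / b)) powr (- 1 / 2) * (a * b) powr (- 1 / 2) = 1"
    using assms by (subst powr_mult[symmetric]) auto
  then have "k' * k = 1" unfolding k_def k'_def of_real_mult[symmetric] by simp
  then have "k' * (k * z) = z" "k * (k' * z) = z" for z by (simp_all add: mult.assoc[symmetric] mult.commute[of k])
  then show "dilate (1 / a) (1 / b) (dilate a b u) = u" "dilate a b (dilate (1 / a) (1 / b) u) = u"
    using assms unfolding dilate_def[abs_def] k_def[symmetric] k'_def[symmetric] by auto
qed

lemma unitary_dilate:
  assumes "a > 0" "b > 0"
  shows "unitary_on_schwartz (dilate a b)"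
proof (rule unitary_on_schwartzI[where T' = "dilate (1 / a) (1 / b)"])
  fix u v :: "plane \<Rightarrow> complex" assume "u \<in> schwartz" "v \<in> schwartz"
  then have [measurable]: "u \<in> borel_measurable borel" "v \<in> borel_measurable borel"
    by (auto simp: schwartz_measurable)
  have [measurable]: "cnj \<in> borel_measurable borel"
    by (intro borel_measurable_continuous_onI continuous_on_cnj continuous_on_id)
  let ?f = "\<lambda>x. u x * cnj (v x)"
  have sq: "(a * b) powr (- 1 / 2) * (a * b) powr (- 1 / 2) = 1 / (a * b)"
    using assms by (subst powr_add[symmetric]) (auto simp: powr_minus_divide)
  have "l2_inner u v = of_real \<bar>1 / a * (1 / b)\<bar> * (\<integral>x. ?f (0 + (1 / a * fst x, 1 / b * snd x)) \<partial>lborel)"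
    unfolding l2_inner_def using assms by (intro integral_plane_scaling) auto
  also have "\<dots> = (\<integral>x. of_real (1 / (a * b)) * ?f (fst x / a, snd x / b) \<partial>lborel)"
    using assms by simp
  also have "\<dots> = l2_inner (dilate a b u) (dilate a b v)"
    unfolding l2_inner_def dilate_def sq[symmetric] by (simp add: mult_ac)
  finally show "l2_inner (dilate a b u) (dilate a b v) = l2_inner u v" ..
qed (use assms in \<open>auto simp: dilate_inverse schwartz_dilate\<close>)

section \<open>Position and momentum operators\<close>

definition position :: "'a::euclidean_space \<Rightarrow> ('a \<Rightarrow> complex) \<Rightarrow> 'a \<Rightarrow> complex" where
  "position b u x = of_real (x \<bullet> b) * u x"

text \<open>The operator \<open>D\<^sub>b\<close>, normalized so that the Fourier transform turns it into multiplication by the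
coordinate \<open>\<xi> \<bullet> b\<close>.\<close>

definition momentum :: "'a::euclidean_space \<Rightarrow> ('a \<Rightarrow> complex) \<Rightarrow> 'a \<Rightarrow> complex" where
  "momentum b u x = partial_deriv b u x / (2 * \<i> * pi)"

abbreviation e1 :: plane where "e1 \<equiv> (1, 0)"
abbreviation e2 :: plane where "e2 \<equiv> (0, 1)"

lemma e_Basis [simp]: "e1 \<in> Basis" "e2 \<in> Basis"
  by (auto simp: Basis_plane)

lemma schwartz_position: "u \<in> schwartz \<Longrightarrow> position b u \<in> schwartz"
  unfolding position_def[abs_def] by (rule schwartz_coord_mult)

lemma schwartz_momentum: "u \<in> schwartz \<Longrightarrow> b \<in> Basis \<Longrightarrow> momentum b u \<in> schwartz"
  using schwartz_scale[OF schwartz_partial_deriv, of u b "1 / (2 * \<i> * pi)"]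
  by (simp add: momentum_def[abs_def])

lemma position_lincomb: "position b (\<lambda>x. p * f x + q * g x) = (\<lambda>x. p * position b f x + q * position b g x)"
  by (auto simp: position_def algebra_simps)

lemma momentum_lincomb:
  "f \<in> schwartz \<Longrightarrow> g \<in> schwartz \<Longrightarrow>
    momentum b (\<lambda>x. p * f x + q * g x) = (\<lambda>x. p * momentum b f x + q * momentum b g x)"
  by (simp add: momentum_def[abs_def] partial_deriv_lincomb add_divide_distrib)

lemma momentum_position_commute:
  assumes "u \<in> schwartz" "b \<bullet> a = 0"
  shows "momentum b (position a u) = position a (momentum b u)"
  using assms by (simp add: momentum_def[abs_def] position_def[abs_def] partial_deriv_coord_mult)

definition schwartz_linear :: "(('a::euclidean_space \<Rightarrow> complex) \<Rightarrow> 'a \<Rightarrow> complex) \<Rightarrow> bool" where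
  "schwartz_linear T \<longleftrightarrow> (\<forall>f\<in>schwartz. \<forall>g\<in>schwartz. \<forall>p q.
     T (\<lambda>x. p * f x + q * g x) = (\<lambda>x. p * T f x + q * T g x))"

lemma schwartz_linearD:
  "schwartz_linear T \<Longrightarrow> f \<in> schwartz \<Longrightarrow> g \<in> schwartz \<Longrightarrow>
     T (\<lambda>x. p * f x + q * g x) = (\<lambda>x. p * T f x + q * T g x)"
  unfolding schwartz_linear_def by blast

lemma schwartz_linear_scale:
  "schwartz_linear T \<Longrightarrow> f \<in> schwartz \<Longrightarrow> T (\<lambda>x. p * f x) = (\<lambda>x. p * T f x)"
  using schwartz_linearD[of T f f p 0] by simp

lemma schwartz_linear_compose:
  assumes "schwartz_linear S" "schwartz_linear T" "\<And>u. u \<in> schwartz \<Longrightarrow> T u \<in> schwartz"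
  shows "schwartz_linear (\<lambda>u. S (T u))"
  using assms unfolding schwartz_linear_def by simp

lemma linear_fourier: "schwartz_linear (fourier :: (plane \<Rightarrow> complex) \<Rightarrow> _)"
  unfolding schwartz_linear_def by (auto simp: fourier_lincomb integrable_schwartz)

lemma linear_inverse_fourier: "schwartz_linear (inverse_fourier :: (plane \<Rightarrow> complex) \<Rightarrow> _)"
  unfolding schwartz_linear_def inverse_fourier_def[abs_def] by (auto simp: fourier_lincomb integrable_schwartz)

lemma linear_chirp: "schwartz_linear (chirp \<theta>)"
  unfolding schwartz_linear_def chirp_def[abs_def] by (auto simp: algebra_simps)

lemma linear_dilate: "schwartz_linear (dilate a b)"
  unfolding schwartz_linear_def dilate_def[abs_def] by (auto simp: algebra_simps)

lemma momentum_fourier: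
  fixes u :: "plane \<Rightarrow> complex"
  assumes "u \<in> schwartz" "b \<in> Basis"
  shows "momentum b (fourier u) = (\<lambda>\<xi>. - fourier (position b u) \<xi>)"
proof
  fix \<xi>
  have "fourier (\<lambda>x. - (2 * \<i> * pi) * position b u x) = (\<lambda>\<xi>. - (2 * \<i> * pi) * fourier (position b u) \<xi>)"
    by (rule schwartz_linear_scale[OF linear_fourier schwartz_position[OF assms(1)]])
  then show "momentum b (fourier u) \<xi> = - fourier (position b u) \<xi>"
    unfolding momentum_def partial_deriv_fourier[OF assms] position_def[symmetric] by simp
qed

lemma position_fourier:
  fixes u :: "plane \<Rightarrow> complex"
  assumes "u \<in> schwartz" "b \<in> Basis"
  shows "position b (fourier u) = fourier (momentum b u)"
proof
  fix \<xi>
  have "fourier (\<lambda>x. 1 / (2 * \<i> * pi) * partial_deriv b u x) \<xi> = 1 / (2 * \<i> * pi) * fourier (partial_deriv b u) \<xi>"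
    by (rule fun_cong[OF schwartz_linear_scale[OF linear_fourier schwartz_partial_deriv[OF assms]]])
  then show "position b (fourier u) \<xi> = fourier (momentum b u) \<xi>"
    unfolding fourier_partial_deriv[OF assms] by (simp add: momentum_def[abs_def] position_def)
qed

lemma position_inverse_fourier:
  fixes u :: "plane \<Rightarrow> complex"
  assumes "u \<in> schwartz" "b \<in> Basis"
  shows "position b (inverse_fourier u) = (\<lambda>x. - inverse_fourier (momentum b u) x)"
proof
  fix x
  have "position b (inverse_fourier u) x = - position b (fourier u) (- x)"
    by (simp add: position_def inverse_fourier_def)
  then show "position b (inverse_fourier u) x = - inverse_fourier (momentum b u) x"
    by (simp add: position_fourier[OF assms] inverse_fourier_def)
qed

lemma momentum_inverse_fourier:
  fixes u :: "plane \<Rightarrow> complex"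
  assumes "u \<in> schwartz" "b \<in> Basis"
  shows "momentum b (inverse_fourier u) = inverse_fourier (position b u)"
proof
  fix x
  let ?v = "fourier u"
  have "partial_deriv b (\<lambda>x. ?v (- x)) x = (\<Sum>e\<in>Basis. of_real ((- b) \<bullet> e) * partial_deriv e ?v (- x))"
    by (rule partial_deriv_comp_linear[OF schwartz_fourier[OF assms(1)] bounded_linear_minus[OF bounded_linear_ident]])
  also have "\<dots> = (\<Sum>e\<in>Basis. if e = b then - partial_deriv e ?v (- x) else 0)"
    using assms(2) by (intro sum.cong) (auto simp: inner_Basis)
  also have "\<dots> = - partial_deriv b ?v (- x)" using assms(2) by simp
  finally have "momentum b (inverse_fourier u) x = - momentum b ?v (- x)"
    by (simp add: momentum_def inverse_fourier_def[abs_def])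
  then show "momentum b (inverse_fourier u) x = inverse_fourier (position b u) x"
    by (simp add: momentum_fourier[OF assms] inverse_fourier_def)
qed

lemma position_chirp: "position b (chirp \<theta> u) = chirp \<theta> (position b u)"
  by (auto simp: position_def chirp_def)

text \<open>A chirp shears phase space: the gradient of \<open>\<theta> x\<^sub>1 x\<^sub>2\<close> has the coordinates in exchanged order,
hence the direction \<open>(snd b, fst b)\<close>.\<close>

lemma momentum_chirp:
  assumes "u \<in> schwartz"
  shows "momentum b (chirp \<theta> u) = chirp \<theta> (\<lambda>x. 1 * momentum b u x + of_real \<theta> * position (snd b, fst b) u x)"
proof
  fix x
  show "momentum b (chirp \<theta> u) x = chirp \<theta> (\<lambda>x. 1 * momentum b u x + of_real \<theta> * position (snd b, fst b) u x) x"
    unfolding momentum_def chirp_def[abs_def] partial_deriv_unimodular_mult(1)[OF assms chirp_phase_has_derivative]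
    by (simp add: position_def inner_prod_def field_simps)
qed

lemma position_dilate:
  assumes "a > 0" "b > 0"
  shows "position e1 (dilate a b u) = dilate a b (\<lambda>x. of_real a * position e1 u x)"
    and "position e2 (dilate a b u) = dilate a b (\<lambda>x. of_real b * position e2 u x)"
  using assms by (auto simp: position_def dilate_def fun_eq_iff inner_prod_def)

lemma momentum_dilate:
  assumes "u \<in> schwartz"
  shows "momentum e1 (dilate a b u) = dilate a b (\<lambda>x. of_real (1 / a) * momentum e1 u x)"
    and "momentum e2 (dilate a b u) = dilate a b (\<lambda>x. of_real (1 / b) * momentum e2 u x)"
proof -
  define k where "k = complex_of_real ((a * b) powr (- 1 / 2))"
  have *: "partial_deriv e (dilate a b u) x = k * (of_real (fst e / a) * partial_deriv e1 u (fst x / a, snd x / b)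
       + of_real (snd e / b) * partial_deriv e2 u (fst x / a, snd x / b))" for e x
  proof -
    have "((\<lambda>x. u (fst x / a, snd x / b)) has_derivative
       frechet_derivative (\<lambda>x. u (fst x / a, snd x / b)) (at x)) (at x)"
      using partial_deriv_comp_linear(2)[OF assms bounded_linear_plane_scaling] frechet_derivative_works by blast
    then have "((\<lambda>x. k * u (fst x / a, snd x / b)) has_derivative
       (\<lambda>h. k * frechet_derivative (\<lambda>x. u (fst x / a, snd x / b)) (at x) h)) (at x)"
      by (rule has_derivative_mult_right)
    then have "partial_deriv e (dilate a b u) x = k * partial_deriv e (\<lambda>x. u (fst x / a, snd x / b)) x"
      unfolding dilate_def[abs_def] k_def[symmetric] by (simp add: partial_deriv_eq) (simp add: partial_deriv_def)
    then show ?thesis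
      unfolding partial_deriv_comp_linear(1)[OF assms bounded_linear_plane_scaling] Basis_plane
      by (simp add: inner_prod_def)
  qed
  show "momentum e1 (dilate a b u) = dilate a b (\<lambda>x. of_real (1 / a) * momentum e1 u x)"
    "momentum e2 (dilate a b u) = dilate a b (\<lambda>x. of_real (1 / b) * momentum e2 u x)"
    unfolding momentum_def[abs_def] * by (auto simp: dilate_def k_def)
qed

section \<open>Conjugation of positions and momenta\<close>

text \<open>The operator \<open>M\<close> with its four constants as independent parameters.\<close>

definition quadratic_unitary :: "real \<Rightarrow> real \<Rightarrow> real \<Rightarrow> real \<Rightarrow> (plane \<Rightarrow> complex) \<Rightarrow> plane \<Rightarrow> complex" where
  "quadratic_unitary \<kappa> a b \<theta> u = chirp \<kappa> (dilate a b (inverse_fourier (chirp \<theta> (fourier u))))"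

lemma unitary_quadratic_unitary:
  assumes "a > 0" "b > 0"
  shows "unitary_on_schwartz (quadratic_unitary \<kappa> a b \<theta>)"
  unfolding quadratic_unitary_def[abs_def]
  by (rule unitary_on_schwartz_compose[OF unitary_chirp unitary_on_schwartz_compose[OF unitary_dilate[OF assms]
        unitary_on_schwartz_compose[OF unitary_inverse_fourier unitary_on_schwartz_compose[OF unitary_chirp unitary_fourier]]]])

lemmas schwartz_closed = schwartz_position schwartz_momentum schwartz_lincomb schwartz_scale
  schwartz_fourier schwartz_inverse_fourier schwartz_chirp schwartz_dilate

lemma linear_multiplier: "schwartz_linear (\<lambda>u. inverse_fourier (chirp \<theta> (fourier u)))"
  by (rule schwartz_linear_compose[OF linear_inverse_fourier schwartz_linear_compose[OF linear_chirp linear_fourier]])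
    (simp_all add: schwartz_closed)

lemma linear_quadratic_unitary:
  assumes "a > 0" "b > 0"
  shows "schwartz_linear (quadratic_unitary \<kappa> a b \<theta>)"
  unfolding quadratic_unitary_def[abs_def]
  by (rule schwartz_linear_compose[OF linear_chirp schwartz_linear_compose[OF linear_dilate linear_multiplier]])
    (simp_all add: schwartz_closed assms)

lemma momentum_multiplier:
  assumes "u \<in> schwartz" "b \<in> Basis"
  shows "momentum b (inverse_fourier (chirp \<theta> (fourier u))) = inverse_fourier (chirp \<theta> (fourier (momentum b u)))"
  using assms by (simp add: momentum_inverse_fourier schwartz_closed position_chirp position_fourier)

text \<open>On the Fourier side a position is a derivative, which the chirp shears by a coordinate multiple;
transforming back, this multiple is a momentum in the other direction.\<close>

lemma position_multiplier:
  assumes u: "u \<in> schwartz" and b: "b \<in> Basis" "(snd b, fst b) \<in> Basis"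
  shows "position b (inverse_fourier (chirp \<theta> (fourier u)))
    = inverse_fourier (chirp \<theta> (fourier (\<lambda>x. 1 * position b u x + of_real (- \<theta>) * momentum (snd b, fst b) u x)))"
proof -
  let ?b = "(snd b, fst b)"
  have lin: "schwartz_linear (\<lambda>u. inverse_fourier (chirp \<theta> (fourier u)))"
    by (rule linear_multiplier)
  have "momentum b (chirp \<theta> (fourier u))
     = chirp \<theta> (\<lambda>x. 1 * momentum b (fourier u) x + of_real \<theta> * position ?b (fourier u) x)"
    by (rule momentum_chirp[OF schwartz_fourier[OF u]])
  also have "(\<lambda>x. 1 * momentum b (fourier u) x + of_real \<theta> * position ?b (fourier u) x)
     = (\<lambda>x. (- 1) * fourier (position b u) x + of_real \<theta> * fourier (momentum ?b u) x)"
    using u b by (simp add: momentum_fourier position_fourier)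
  also have "\<dots> = fourier (\<lambda>x. (- 1) * position b u x + of_real \<theta> * momentum ?b u x)"
    using u b by (intro schwartz_linearD[OF linear_fourier, symmetric] schwartz_closed)
  finally have "position b (inverse_fourier (chirp \<theta> (fourier u)))
     = (\<lambda>x. - inverse_fourier (chirp \<theta> (fourier (\<lambda>x. (- 1) * position b u x + of_real \<theta> * momentum ?b u x))) x)"
    using u b by (simp only: position_inverse_fourier schwartz_closed)
  also have "\<dots> = (\<lambda>x. (- 1) * inverse_fourier (chirp \<theta> (fourier (\<lambda>x. (- 1) * position b u x + of_real \<theta> * momentum ?b u x))) x)"
    by simp
  also have "\<dots> = inverse_fourier (chirp \<theta> (fourier (\<lambda>x. (- 1) * ((- 1) * position b u x + of_real \<theta> * momentum ?b u x))))"
    using u b by (intro schwartz_linear_scale[OF lin, symmetric] schwartz_closed)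
  finally show ?thesis by (simp add: algebra_simps)
qed

context
  fixes \<kappa> a b \<theta> :: real
  assumes ab: "a > 0" "b > 0"
begin

lemma position_quadratic_unitary:
  assumes u: "u \<in> schwartz"
  shows "position e1 (quadratic_unitary \<kappa> a b \<theta> u)
      = quadratic_unitary \<kappa> a b \<theta> (\<lambda>x. of_real a * position e1 u x + of_real (- a * \<theta>) * momentum e2 u x)"
    and "position e2 (quadratic_unitary \<kappa> a b \<theta> u)
      = quadratic_unitary \<kappa> a b \<theta> (\<lambda>x. of_real b * position e2 u x + of_real (- b * \<theta>) * momentum e1 u x)"
proof -
  let ?E = "\<lambda>u. inverse_fourier (chirp \<theta> (fourier u))"
  have lin: "schwartz_linear ?E"
    by (rule linear_multiplier)
  have E: "(\<lambda>x. p * position c (?E u) x)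
      = ?E (\<lambda>x. p * (1 * position c u x + of_real (- \<theta>) * momentum (snd c, fst c) u x))"
    if "c = e1 \<or> c = e2" for c p
  proof -
    from that have c: "c \<in> Basis" "(snd c, fst c) \<in> Basis" by auto
    show ?thesis unfolding position_multiplier[OF u c]
      using u c by (intro schwartz_linear_scale[OF lin, symmetric] schwartz_closed)
  qed
  show "position e1 (quadratic_unitary \<kappa> a b \<theta> u)
      = quadratic_unitary \<kappa> a b \<theta> (\<lambda>x. of_real a * position e1 u x + of_real (- a * \<theta>) * momentum e2 u x)"
    unfolding quadratic_unitary_def position_chirp position_dilate[OF ab] E[OF disjI1[OF refl]]
    by (simp add: algebra_simps)
  show "position e2 (quadratic_unitary \<kappa> a b \<theta> u)
      = quadratic_unitary \<kappa> a b \<theta> (\<lambda>x. of_real b * position e2 u x + of_real (- b * \<theta>) * momentum e1 u x)"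
    unfolding quadratic_unitary_def position_chirp position_dilate[OF ab] E[OF disjI2[OF refl]]
    by (simp add: algebra_simps)
qed

lemma momentum_quadratic_unitary:
  assumes u: "u \<in> schwartz"
  shows "momentum e1 (quadratic_unitary \<kappa> a b \<theta> u)
      = quadratic_unitary \<kappa> a b \<theta> (\<lambda>x. of_real (\<kappa> * b) * position e2 u x + of_real (1 / a - \<kappa> * b * \<theta>) * momentum e1 u x)"
    and "momentum e2 (quadratic_unitary \<kappa> a b \<theta> u)
      = quadratic_unitary \<kappa> a b \<theta> (\<lambda>x. of_real (\<kappa> * a) * position e1 u x + of_real (1 / b - \<kappa> * a * \<theta>) * momentum e2 u x)"
proof -
  let ?E = "\<lambda>u. inverse_fourier (chirp \<theta> (fourier u))"
  let ?DE = "\<lambda>u. dilate a b (?E u)"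
  have DE: "?DE u \<in> schwartz" if "u \<in> schwartz" for u using that ab by (intro schwartz_closed)
  have linE: "schwartz_linear ?E"
    by (rule linear_multiplier)
  then have lin: "schwartz_linear ?DE"
    by (rule schwartz_linear_compose[OF linear_dilate]) (intro schwartz_closed)
  note E = schwartz_linear_scale[OF linE, symmetric]
  have "momentum e1 (?DE u) = ?DE (\<lambda>x. of_real (1 / a) * momentum e1 u x)"
    using u by (simp only: momentum_dilate momentum_multiplier e_Basis E schwartz_closed)
  moreover have "position e2 (?DE u) = ?DE (\<lambda>x. of_real b * (1 * position e2 u x + of_real (- \<theta>) * momentum e1 u x))"
    using u by (simp only: position_dilate[OF ab] position_multiplier e_Basis fst_conv snd_conv E schwartz_closed)
  moreover have "(\<lambda>x. 1 * ?DE (\<lambda>x. of_real (1 / a) * momentum e1 u x) x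
      + of_real \<kappa> * ?DE (\<lambda>x. of_real b * (1 * position e2 u x + of_real (- \<theta>) * momentum e1 u x)) x)
    = ?DE (\<lambda>x. 1 * (of_real (1 / a) * momentum e1 u x)
       + of_real \<kappa> * (of_real b * (1 * position e2 u x + of_real (- \<theta>) * momentum e1 u x)))"
    using u by (intro schwartz_linearD[OF lin, symmetric] schwartz_closed) auto
  ultimately show "momentum e1 (quadratic_unitary \<kappa> a b \<theta> u)
      = quadratic_unitary \<kappa> a b \<theta> (\<lambda>x. of_real (\<kappa> * b) * position e2 u x + of_real (1 / a - \<kappa> * b * \<theta>) * momentum e1 u x)"
    unfolding quadratic_unitary_def momentum_chirp[OF DE[OF u]] by (simp add: algebra_simps)
  have "momentum e2 (?DE u) = ?DE (\<lambda>x. of_real (1 / b) * momentum e2 u x)"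
    using u by (simp only: momentum_dilate momentum_multiplier e_Basis E schwartz_closed)
  moreover have "position e1 (?DE u) = ?DE (\<lambda>x. of_real a * (1 * position e1 u x + of_real (- \<theta>) * momentum e2 u x))"
    using u by (simp only: position_dilate[OF ab] position_multiplier e_Basis fst_conv snd_conv E schwartz_closed)
  moreover have "(\<lambda>x. 1 * ?DE (\<lambda>x. of_real (1 / b) * momentum e2 u x) x
      + of_real \<kappa> * ?DE (\<lambda>x. of_real a * (1 * position e1 u x + of_real (- \<theta>) * momentum e2 u x)) x)
    = ?DE (\<lambda>x. 1 * (of_real (1 / b) * momentum e2 u x)
       + of_real \<kappa> * (of_real a * (1 * position e1 u x + of_real (- \<theta>) * momentum e2 u x)))"
    using u by (intro schwartz_linearD[OF lin, symmetric] schwartz_closed) auto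
  ultimately show "momentum e2 (quadratic_unitary \<kappa> a b \<theta> u)
      = quadratic_unitary \<kappa> a b \<theta> (\<lambda>x. of_real (\<kappa> * a) * position e1 u x + of_real (1 / b - \<kappa> * a * \<theta>) * momentum e2 u x)"
    unfolding quadratic_unitary_def momentum_chirp[OF DE[OF u]] by (simp add: algebra_simps)
qed

end

section \<open>Weyl quantization of quadratic forms\<close>

text \<open>For fixed \<open>x\<close>, the inner integral is \<open>exp (2 i \<pi> x \<bullet> \<xi>)\<close> times the Fourier transform of products
of \<open>u\<close> with midpoint coordinates, and the powers of \<open>\<xi>\<close> are absorbed as momenta acting on
those products. So the integrand is the transform of one Schwartz function \<open>h\<close>, and inversion gives
\<open>h x\<close>. At the point \<open>x\<close> itself the midpoint is \<open>x\<close>; no further term arises because \<open>D\<^sub>1\<close> only meets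
the second midpoint coordinate and \<open>D\<^sub>2\<close> only the first.\<close>

lemma weyl_quadratic:
  assumes u: "u \<in> schwartz"
    and a: "\<And>z \<xi>. a (phase_point z \<xi>) = of_real ((fst \<xi>)\<^sup>2 + (snd \<xi>)\<^sup>2 + A * (fst z)\<^sup>2 + B * (snd z)\<^sup>2
              - 2 * w * (fst z * snd \<xi> - snd z * fst \<xi>))"
  shows "weyl a u = (\<lambda>x. momentum e1 (momentum e1 u) x + momentum e2 (momentum e2 u) x
     + of_real A * position e1 (position e1 u) x + of_real B * position e2 (position e2 u) x
     - 2 * of_real w * (position e1 (momentum e2 u) x - position e2 (momentum e1 u) x))"
proof
  fix x :: plane
  let ?x = "\<lambda>b. complex_of_real (x \<bullet> b)"
  \<comment> \<open>The midpoint coordinate \<open>((x + y) / 2) \<bullet> b\<close>, as a multiplication operator in \<open>y\<close>.\<close>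
  define Z where "Z b f = (\<lambda>y. ?x b / 2 * f y + 1 / 2 * position b f y)" for b f
  have Z: "Z b f \<in> schwartz" if "f \<in> schwartz" for b f
    unfolding Z_def using that by (intro schwartz_closed)
  have Z_diag: "Z b f x = ?x b * f x" for b f
    by (simp add: Z_def position_def)
  have Z_mult: "Z e1 f y = of_real ((fst x + fst y) / 2) * f y" "Z e2 f y = of_real ((snd x + snd y) / 2) * f y" for f y
    by (simp_all add: Z_def position_def inner_prod_def field_simps)
  have P_Z: "momentum b (Z c u) x = position c (momentum b u) x" if "b \<bullet> c = 0" "b \<in> Basis" for b c
    unfolding Z_def momentum_lincomb[OF u schwartz_position[OF u]] momentum_position_commute[OF u that(1)]
    by (simp add: position_def)
  define h0 where "h0 = (\<lambda>y. of_real A * Z e1 (Z e1 u) y + of_real B * Z e2 (Z e2 u) y)"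
  define h1 where "h1 = (\<lambda>y. 1 * h0 y + (- 2 * of_real w) * momentum e2 (Z e1 u) y)"
  define h2 where "h2 = (\<lambda>y. 1 * h1 y + (2 * of_real w) * momentum e1 (Z e2 u) y)"
  define h3 where "h3 = (\<lambda>y. 1 * h2 y + 1 * momentum e1 (momentum e1 u) y)"
  define h where "h = (\<lambda>y. 1 * h3 y + 1 * momentum e2 (momentum e2 u) y)"
  have h0: "h0 \<in> schwartz" unfolding h0_def using u by (intro schwartz_closed Z)
  have h1: "h1 \<in> schwartz" unfolding h1_def using u by (intro schwartz_closed Z h0) auto
  have h2: "h2 \<in> schwartz" unfolding h2_def using u by (intro schwartz_closed Z h1) auto
  have h3: "h3 \<in> schwartz" unfolding h3_def using u by (intro schwartz_closed Z h2) auto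
  have h: "h \<in> schwartz" unfolding h_def using u by (intro schwartz_closed Z h3) auto
  let ?e = "\<lambda>\<xi>. exp (\<i> * of_real (- 2 * pi * ((- x) \<bullet> \<xi>)))"
  have inner: "(\<integral>x'. exp (2 * \<i> * pi * ((x - x') \<bullet> \<xi>)) * a (phase_point ((1 / 2) *\<^sub>R (x + x')) \<xi>) * u x' \<partial>lborel)
      = ?e \<xi> * fourier h \<xi>" for \<xi>
  proof -
    \<comment> \<open>For fixed \<open>\<xi>\<close> the inner integrand is a character times this combination \<open>g\<close>; its transform agrees
        with that of \<open>h\<close> at \<open>\<xi>\<close> only.\<close>
    define g1 where "g1 = (\<lambda>y. 1 * h0 y + of_real (- 2 * w * snd \<xi>) * Z e1 u y)"
    define g2 where "g2 = (\<lambda>y. 1 * g1 y + of_real (2 * w * fst \<xi>) * Z e2 u y)"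
    define g where "g = (\<lambda>y. 1 * g2 y + of_real ((fst \<xi>)\<^sup>2 + (snd \<xi>)\<^sup>2) * u y)"
    have g1: "g1 \<in> schwartz" unfolding g1_def using u by (intro schwartz_closed Z h0)
    have g2: "g2 \<in> schwartz" unfolding g2_def using u by (intro schwartz_closed Z g1)
    have F: "fourier (momentum b f) \<xi> = of_real (\<xi> \<bullet> b) * fourier f \<xi>" if "f \<in> schwartz" "b \<in> Basis" for f b
      using fun_cong[OF position_fourier[OF that], of \<xi>] by (simp add: position_def)
    have "fourier g \<xi> = fourier h0 \<xi> - 2 * of_real w * of_real (snd \<xi>) * fourier (Z e1 u) \<xi>
       + 2 * of_real w * of_real (fst \<xi>) * fourier (Z e2 u) \<xi> + of_real ((fst \<xi>)\<^sup>2 + (snd \<xi>)\<^sup>2) * fourier u \<xi>"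
      unfolding g_def fourier_lincomb[OF integrable_schwartz[OF g2] integrable_schwartz[OF u]]
      unfolding g2_def fourier_lincomb[OF integrable_schwartz[OF g1] integrable_schwartz[OF Z[OF u]]]
      unfolding g1_def fourier_lincomb[OF integrable_schwartz[OF h0] integrable_schwartz[OF Z[OF u]]]
      by simp
    also have "\<dots> = fourier h \<xi>"
      unfolding h_def fourier_lincomb[OF integrable_schwartz[OF h3] integrable_schwartz[OF
            schwartz_momentum[OF schwartz_momentum[OF u e_Basis(2)] e_Basis(2)]]]
      unfolding h3_def fourier_lincomb[OF integrable_schwartz[OF h2] integrable_schwartz[OF
            schwartz_momentum[OF schwartz_momentum[OF u e_Basis(1)] e_Basis(1)]]]
      unfolding h2_def fourier_lincomb[OF integrable_schwartz[OF h1] integrable_schwartz[OF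
            schwartz_momentum[OF Z[OF u] e_Basis(1)]]]
      unfolding h1_def fourier_lincomb[OF integrable_schwartz[OF h0] integrable_schwartz[OF
            schwartz_momentum[OF Z[OF u] e_Basis(2)]]]
      using u by (simp add: F schwartz_momentum Z inner_prod_def algebra_simps power2_eq_square)
    finally have gh: "fourier g \<xi> = fourier h \<xi>" .
    have "exp (2 * \<i> * pi * ((x - y) \<bullet> \<xi>)) * a (phase_point ((1 / 2) *\<^sub>R (x + y)) \<xi>) * u y
       = ?e \<xi> * (exp (\<i> * of_real (- 2 * pi * (y \<bullet> \<xi>))) * g y)" for y
    proof -
      define s1 s2 where "s1 = (fst x + fst y) / 2" and "s2 = (snd x + snd y) / 2"
      have s: "fst ((1 / 2) *\<^sub>R (x + y)) = s1" "snd ((1 / 2) *\<^sub>R (x + y)) = s2"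
        by (simp_all add: s1_def s2_def)
      have "exp (2 * \<i> * pi * ((x - y) \<bullet> \<xi>)) = ?e \<xi> * exp (\<i> * of_real (- 2 * pi * (y \<bullet> \<xi>)))"
        unfolding exp_add[symmetric] by (simp add: inner_diff_left algebra_simps)
      moreover have "a (phase_point ((1 / 2) *\<^sub>R (x + y)) \<xi>) * u y = g y"
        unfolding a s g_def g2_def g1_def h0_def Z_mult s1_def[symmetric] s2_def[symmetric]
        by (simp add: power2_eq_square algebra_simps)
      ultimately show ?thesis by (simp only: mult.assoc)
    qed
    then show ?thesis unfolding gh[symmetric] fourier_alt[of g] by (simp only: integral_mult_right_zero)
  qed
  have "weyl a u x = inverse_fourier (fourier h) x"
    unfolding weyl_def inner inverse_fourier_def fourier_alt[of "fourier h"] by (simp only: inner_commute)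
  also have "\<dots> = h x" by (simp only: inverse_fourier_fourier[OF h])
  also have "\<dots> = momentum e1 (momentum e1 u) x + momentum e2 (momentum e2 u) x
     + of_real A * position e1 (position e1 u) x + of_real B * position e2 (position e2 u) x
     - 2 * of_real w * (position e1 (momentum e2 u) x - position e2 (momentum e1 u) x)"
    unfolding h_def h3_def h2_def h1_def h0_def Z_diag
    by (simp add: P_Z) (simp add: position_def algebra_simps)
  finally show "weyl a u x = \<dots>" .
qed

section \<open>Uniqueness of the adjoint\<close>

text \<open>The zero set has full measure, and a nonempty open set is not negligible.\<close>

lemma schwartz_eq_zero:
  fixes u :: "plane \<Rightarrow> complex"
  assumes u: "u \<in> schwartz" and "l2_inner u u = 0"
  shows "u = (\<lambda>x. 0)"
proof -
  have [measurable]: "u \<in> borel_measurable borel" using u by (rule schwartz_measurable)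
  obtain C where C: "\<And>x. norm (u x) \<le> C" using schwartz_bounded[OF u] by blast
  have "u x * cnj (u x) = of_real ((norm (u x))\<^sup>2)" for x by (rule complex_norm_square[symmetric])
  then have "(\<integral>x. complex_of_real ((norm (u x))\<^sup>2) \<partial>lborel) = 0"
    using assms(2) unfolding l2_inner_def by (simp only:)
  then have zero: "(\<integral>x. (norm (u x))\<^sup>2 \<partial>lborel) = 0"
    by (simp only: integral_complex_of_real of_real_eq_0_iff)
  have "integrable lborel (\<lambda>x. norm (u x) * norm (u x))"
  proof (rule Bochner_Integration.integrable_bound)
    show "integrable lborel (\<lambda>x. C * norm (u x))"
      using integrable_schwartz[OF u] by (intro integrable_mult_right integrable_norm)
    show "AE x in lborel. norm (norm (u x) * norm (u x)) \<le> norm (C * norm (u x))"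
      using C order_trans[OF norm_ge_zero C] by (auto simp: abs_mult intro!: mult_right_mono)
  qed measurable
  then have "AE x in lborel. (norm (u x))\<^sup>2 = 0"
    using zero integral_nonneg_eq_0_iff_AE[of lborel "\<lambda>x. (norm (u x))\<^sup>2"] by (simp add: power2_eq_square)
  then have "{x. u x \<noteq> 0} \<in> null_sets lborel"
    by (subst AE_iff_null_sets) auto
  then have "negligible {x. u x \<noteq> 0}"
    by (simp add: negligible_iff_null_sets null_sets_completionI)
  moreover have "open {x. u x \<noteq> 0}"
    using schwartz_continuous[OF u] by (intro open_Collect_neq) auto
  ultimately have "{x. u x \<noteq> 0} = {}" using open_not_negligible by blast
  then show ?thesis by auto
qed

text \<open>Two candidates for the adjoint have a difference that is orthogonal to every Schwartz function, in
particular to itself.\<close>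

lemma adjoint_op_eqI:
  fixes T :: "(plane \<Rightarrow> complex) \<Rightarrow> plane \<Rightarrow> complex"
  assumes w: "w \<in> schwartz" and adj: "\<And>u. u \<in> schwartz \<Longrightarrow> l2_inner (T u) v = l2_inner u w"
  shows "adjoint_op T v = w"
  unfolding adjoint_op_def
proof (rule the_equality)
  fix w' assume w': "w' \<in> schwartz \<and> (\<forall>u\<in>schwartz. l2_inner (T u) v = l2_inner u w')"
  define d where "d = (\<lambda>x. 1 * w' x + (- 1) * w x)"
  have d: "d \<in> schwartz" unfolding d_def using w w' by (intro schwartz_lincomb) auto
  have int: "integrable lborel (\<lambda>x. cnj (f x) * d x)" if f: "f \<in> schwartz" for f
  proof -
    obtain C where "\<And>x. norm (f x) \<le> C" using schwartz_bounded[OF f] by blast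
    moreover have "(\<lambda>x. cnj (f x)) \<in> borel_measurable lborel"
      using schwartz_continuous[OF f] by (auto intro!: borel_measurable_continuous_onI continuous_on_cnj)
    ultimately show ?thesis by (intro integrable_mult_bounded[OF integrable_schwartz[OF d]]) auto
  qed
  have "l2_inner d w' = l2_inner d w" using d w' adj by metis
  have "l2_inner d d = (\<integral>x. cnj (w' x) * d x - cnj (w x) * d x \<partial>lborel)"
    unfolding l2_inner_def by (rule Bochner_Integration.integral_cong) (auto simp: d_def algebra_simps)
  also have "\<dots> = (\<integral>x. cnj (w' x) * d x \<partial>lborel) - (\<integral>x. cnj (w x) * d x \<partial>lborel)"
    using w w' by (intro Bochner_Integration.integral_diff int) auto
  also have "\<dots> = 0"
    using \<open>l2_inner d w' = l2_inner d w\<close> unfolding l2_inner_def by (simp add: mult.commute)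
  finally have "l2_inner d d = 0" .
  from schwartz_eq_zero[OF d this] show "w' = w" by (auto simp: d_def fun_eq_iff)
qed (use assms in auto)

section \<open>Conjugation of the quadratic operator\<close>

text \<open>The quantization of
\<open>\<xi>\<^sub>1\<^sup>2 + \<xi>\<^sub>2\<^sup>2 + A x\<^sub>1\<^sup>2 + B x\<^sub>2\<^sup>2 - 2 w (x\<^sub>1 \<xi>\<^sub>2 - x\<^sub>2 \<xi>\<^sub>1)\<close>.\<close>

definition quadratic_operator :: "real \<Rightarrow> real \<Rightarrow> real \<Rightarrow> (plane \<Rightarrow> complex) \<Rightarrow> plane \<Rightarrow> complex" where
  "quadratic_operator A B w u x = momentum e1 (momentum e1 u) x + momentum e2 (momentum e2 u) x
     + of_real A * position e1 (position e1 u) x + of_real B * position e2 (position e2 u) x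
     - 2 * of_real w * (position e1 (momentum e2 u) x - position e2 (momentum e1 u) x)"

text \<open>The quantization of a row \<open>p y\<^sub>e + r \<eta>\<^sub>e\<^sub>'\<close> of \<open>\<chi>\<close>; the directions \<open>e\<close> and \<open>e'\<close> will be
orthogonal, so that the two terms commute.\<close>

definition mixed :: "plane \<Rightarrow> plane \<Rightarrow> real \<Rightarrow> real \<Rightarrow> (plane \<Rightarrow> complex) \<Rightarrow> plane \<Rightarrow> complex" where
  "mixed e e' p r u x = of_real p * position e u x + of_real r * momentum e' u x"

lemma schwartz_mixed: "u \<in> schwartz \<Longrightarrow> e' \<in> Basis \<Longrightarrow> mixed e e' p r u \<in> schwartz"
  unfolding mixed_def[abs_def] by (intro schwartz_closed)

lemma mixed_mixed:
  assumes u: "u \<in> schwartz" and e: "e' \<in> Basis" "e' \<bullet> e = 0"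
  shows "mixed e e' p r (mixed e e' p' r' u) x = of_real (p * p') * position e (position e u) x
    + of_real (p * r' + r * p') * position e (momentum e' u) x + of_real (r * r') * momentum e' (momentum e' u) x"
proof -
  have m: "mixed e e' p' r' u = (\<lambda>x. of_real p' * position e u x + of_real r' * momentum e' u x)"
    by (auto simp: mixed_def)
  show ?thesis
    unfolding mixed_def[of e e' p r] m position_lincomb
      momentum_lincomb[OF schwartz_position[OF u] schwartz_momentum[OF u e(1)]] momentum_position_commute[OF u e(2)]
    by (simp add: algebra_simps)
qed

text \<open>By \<open>mixed_mixed\<close> the rows multiply like commuting linear forms, so \<open>T\<close> conjugates the operator into
the one whose coefficients come from substituting the rows into the quadratic form. The
hypotheses \<open>c1\<close> to \<open>c6\<close> state what these coefficients are.\<close>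

lemma quadratic_operator_intertwine:
  fixes A B w A' B' p1 r1 p2 r2 p3 r3 p4 r4 :: real
  assumes lin: "schwartz_linear T"
    and X1: "\<And>u. u \<in> schwartz \<Longrightarrow> position e1 (T u) = T (mixed e1 e2 p1 r1 u)"
    and X2: "\<And>u. u \<in> schwartz \<Longrightarrow> position e2 (T u) = T (mixed e2 e1 p2 r2 u)"
    and P1: "\<And>u. u \<in> schwartz \<Longrightarrow> momentum e1 (T u) = T (mixed e2 e1 p3 r3 u)"
    and P2: "\<And>u. u \<in> schwartz \<Longrightarrow> momentum e2 (T u) = T (mixed e1 e2 p4 r4 u)"
    and c1: "p4\<^sup>2 + A * p1\<^sup>2 - 2 * w * (p1 * p4) = A'"
    and c2: "p3\<^sup>2 + B * p2\<^sup>2 + 2 * w * (p2 * p3) = B'"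
    and c3: "r4\<^sup>2 + A * r1\<^sup>2 - 2 * w * (r1 * r4) = 1"
    and c4: "r3\<^sup>2 + B * r2\<^sup>2 + 2 * w * (r2 * r3) = 1"
    and c5: "p4 * r4 + A * (p1 * r1) - w * (p1 * r4 + r1 * p4) = 0"
    and c6: "p3 * r3 + B * (p2 * r2) + w * (p2 * r3 + r2 * p3) = 0"
    and u: "u \<in> schwartz"
  shows "quadratic_operator A B w (T u) = T (quadratic_operator A' B' 0 u)"
proof -
  let ?A1 = "mixed e1 e2 p1 r1" and ?A2 = "mixed e2 e1 p2 r2" and ?A3 = "mixed e2 e1 p3 r3" and ?A4 = "mixed e1 e2 p4 r4"
  \<comment> \<open>The sum is built up in two-term steps, with explicit factors 1, to match \<open>schwartz_linearD\<close>.\<close>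
  define w1 where "w1 = (\<lambda>x. 1 * ?A3 (?A3 u) x + 1 * ?A4 (?A4 u) x)"
  define w2 where "w2 = (\<lambda>x. 1 * w1 x + of_real A * ?A1 (?A1 u) x)"
  define w3 where "w3 = (\<lambda>x. 1 * w2 x + of_real B * ?A2 (?A2 u) x)"
  define w4 where "w4 = (\<lambda>x. 1 * w3 x + of_real (- 2 * w) * ?A1 (?A4 u) x)"
  define w5 where "w5 = (\<lambda>x. 1 * w4 x + of_real (2 * w) * ?A2 (?A3 u) x)"
  have A: "?A3 (?A3 u) \<in> schwartz" "?A4 (?A4 u) \<in> schwartz" "?A1 (?A1 u) \<in> schwartz" "?A2 (?A2 u) \<in> schwartz"
    "?A1 (?A4 u) \<in> schwartz" "?A2 (?A3 u) \<in> schwartz"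
    using u by (simp_all add: schwartz_mixed)
  have w1: "w1 \<in> schwartz" unfolding w1_def by (intro schwartz_lincomb A)
  have w2: "w2 \<in> schwartz" unfolding w2_def by (intro schwartz_lincomb A w1)
  have w3: "w3 \<in> schwartz" unfolding w3_def by (intro schwartz_lincomb A w2)
  have w4: "w4 \<in> schwartz" unfolding w4_def by (intro schwartz_lincomb A w3)
  have Tw: "T w5 = (\<lambda>x. T (?A3 (?A3 u)) x + T (?A4 (?A4 u)) x + of_real A * T (?A1 (?A1 u)) x
      + of_real B * T (?A2 (?A2 u)) x - 2 * of_real w * (T (?A1 (?A4 u)) x - T (?A2 (?A3 u)) x))"
    unfolding w5_def schwartz_linearD[OF lin w4 A(6)]
    unfolding w4_def schwartz_linearD[OF lin w3 A(5)]
    unfolding w3_def schwartz_linearD[OF lin w2 A(4)]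
    unfolding w2_def schwartz_linearD[OF lin w1 A(3)]
    unfolding w1_def schwartz_linearD[OF lin A(1) A(2)]
    by (simp add: algebra_simps)
  have q: "quadratic_operator A B w (T u) = T w5"
    unfolding Tw quadratic_operator_def[abs_def]
    using u by (simp add: X1 X2 P1 P2 schwartz_mixed)
  have "w5 x = quadratic_operator A' B' 0 u x" for x
  proof -
    have "w5 x = of_real (p4\<^sup>2 + A * p1\<^sup>2 - 2 * w * (p1 * p4)) * position e1 (position e1 u) x
      + of_real (p3\<^sup>2 + B * p2\<^sup>2 + 2 * w * (p2 * p3)) * position e2 (position e2 u) x
      + of_real (r4\<^sup>2 + A * r1\<^sup>2 - 2 * w * (r1 * r4)) * momentum e2 (momentum e2 u) x
      + of_real (r3\<^sup>2 + B * r2\<^sup>2 + 2 * w * (r2 * r3)) * momentum e1 (momentum e1 u) x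
      + 2 * of_real (p4 * r4 + A * (p1 * r1) - w * (p1 * r4 + r1 * p4)) * position e1 (momentum e2 u) x
      + 2 * of_real (p3 * r3 + B * (p2 * r2) + w * (p2 * r3 + r2 * p3)) * position e2 (momentum e1 u) x"
      unfolding w5_def w4_def w3_def w2_def w1_def
      using u by (simp add: mixed_mixed power2_eq_square algebra_simps)
    then show ?thesis unfolding c1 c2 c3 c4 c5 c6 by (simp add: quadratic_operator_def)
  qed
  then have "w5 = quadratic_operator A' B' 0 u" ..
  then show ?thesis using q by simp
qed

lemma schwartz_quadratic_operator:
  assumes "u \<in> schwartz"
  shows "quadratic_operator A B 0 u \<in> schwartz"
proof -
  have "(\<lambda>x. 1 * (1 * (1 * momentum e1 (momentum e1 u) x + 1 * momentum e2 (momentum e2 u) x)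
     + of_real A * position e1 (position e1 u) x) + of_real B * position e2 (position e2 u) x) \<in> schwartz"
    using assms by (intro schwartz_lincomb) (simp_all add: schwartz_closed)
  then show ?thesis by (simp add: quadratic_operator_def[abs_def])
qed

section \<open>The symplectic matrix and the diagonal form\<close>

text \<open>The entries of \<open>\<chi>\<close> after elimination of \<open>c\<close> and \<open>d\<close>, with \<open>n = \<nu>\<^sup>2\<close> and \<open>a = \<alpha>\<close>: the first six
identities are the coefficients of \<open>q \<circ> \<chi>\<close>, the last four say that \<open>\<chi>\<close> is symplectic. Once the
denominators are cleared, everything follows from \<open>a\<^sup>2 = n\<^sup>2 + 4 w\<^sup>2\<close>.\<close>

lemma chi_coefficients:
  fixes w n a l1 l2 :: real
  assumes pos: "w > 0" "a > 0" "l1 > 0" "l2 > 0"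
    and a2: "a\<^sup>2 = n\<^sup>2 + 4 * w\<^sup>2"
    and l1: "2 * a * l1\<^sup>2 = a - 2 * w\<^sup>2 + n" and l2: "2 * a * l2\<^sup>2 = a + 2 * w\<^sup>2 + n"
  defines "p3 \<equiv> l2 * (a - n) / (2 * w)" and "p4 \<equiv> l1 * (a - n) / (2 * w)"
    and "r1 \<equiv> - w / (a * l2)" and "r2 \<equiv> - w / (a * l1)"
    and "r3 \<equiv> (a + n) / (2 * a * l1)" and "r4 \<equiv> (a + n) / (2 * a * l2)"
  shows "p4\<^sup>2 + (1 - n) * l1\<^sup>2 - 2 * w * (l1 * p4) = 1 + w\<^sup>2 - a"
    and "p3\<^sup>2 + (1 + n) * l2\<^sup>2 + 2 * w * (l2 * p3) = 1 + w\<^sup>2 + a"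
    and "r4\<^sup>2 + (1 - n) * r1\<^sup>2 - 2 * w * (r1 * r4) = 1"
    and "r3\<^sup>2 + (1 + n) * r2\<^sup>2 + 2 * w * (r2 * r3) = 1"
    and "p4 * r4 + (1 - n) * (l1 * r1) - w * (l1 * r4 + r1 * p4) = 0"
    and "p3 * r3 + (1 + n) * (l2 * r2) + w * (l2 * r3 + r2 * p3) = 0"
    and "l1 * r3 - r2 * p4 = 1" and "l2 * r4 - r1 * p3 = 1" and "l1 * p3 = l2 * p4" and "r1 * r3 = r2 * r4"
proof -
  show "p4\<^sup>2 + (1 - n) * l1\<^sup>2 - 2 * w * (l1 * p4) = 1 + w\<^sup>2 - a"
  proof -
    have "(4 * w\<^sup>2 * (2 * a)) * (p4\<^sup>2 + (1 - n) * l1\<^sup>2 - 2 * w * (l1 * p4))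
       = ((a - n)\<^sup>2 + 4 * w\<^sup>2 * (1 - n) - 4 * w\<^sup>2 * (a - n)) * (2 * a * l1\<^sup>2)"
      using pos unfolding p4_def by (simp add: field_simps power2_eq_square)
    also have "\<dots> = (4 * w\<^sup>2 * (2 * a)) * (1 + w\<^sup>2 - a)"
      unfolding l1 using a2 by algebra
    finally show ?thesis using pos by simp
  qed
  show "p3\<^sup>2 + (1 + n) * l2\<^sup>2 + 2 * w * (l2 * p3) = 1 + w\<^sup>2 + a"
  proof -
    have "(4 * w\<^sup>2 * (2 * a)) * (p3\<^sup>2 + (1 + n) * l2\<^sup>2 + 2 * w * (l2 * p3))
       = ((a - n)\<^sup>2 + 4 * w\<^sup>2 * (1 + n) + 4 * w\<^sup>2 * (a - n)) * (2 * a * l2\<^sup>2)"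
      using pos unfolding p3_def by (simp add: field_simps power2_eq_square)
    also have "\<dots> = (4 * w\<^sup>2 * (2 * a)) * (1 + w\<^sup>2 + a)"
      unfolding l2 using a2 by algebra
    finally show ?thesis using pos by simp
  qed
  show "r4\<^sup>2 + (1 - n) * r1\<^sup>2 - 2 * w * (r1 * r4) = 1"
  proof -
    have "(2 * a * (2 * a * l2\<^sup>2)) * (r4\<^sup>2 + (1 - n) * r1\<^sup>2 - 2 * w * (r1 * r4))
       = (a + n)\<^sup>2 + 4 * w\<^sup>2 * (1 - n) + 4 * w\<^sup>2 * (a + n)"
      using pos unfolding r4_def r1_def by (simp add: field_simps power2_eq_square)
    also have "\<dots> = (2 * a * (2 * a * l2\<^sup>2)) * 1"
      unfolding l2 using a2 by algebra
    finally show ?thesis using pos by simp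
  qed
  show "r3\<^sup>2 + (1 + n) * r2\<^sup>2 + 2 * w * (r2 * r3) = 1"
  proof -
    have "(2 * a * (2 * a * l1\<^sup>2)) * (r3\<^sup>2 + (1 + n) * r2\<^sup>2 + 2 * w * (r2 * r3))
       = (a + n)\<^sup>2 + 4 * w\<^sup>2 * (1 + n) - 4 * w\<^sup>2 * (a + n)"
      using pos unfolding r3_def r2_def by (simp add: field_simps power2_eq_square)
    also have "\<dots> = (2 * a * (2 * a * l1\<^sup>2)) * 1"
      unfolding l1 using a2 by algebra
    finally show ?thesis using pos by simp
  qed
  show "p4 * r4 + (1 - n) * (l1 * r1) - w * (l1 * r4 + r1 * p4) = 0"
  proof -
    have "(4 * a * w * l2) * (p4 * r4 + (1 - n) * (l1 * r1) - w * (l1 * r4 + r1 * p4))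
       = l1 * (a\<^sup>2 - n\<^sup>2 - 4 * w\<^sup>2)"
      using pos unfolding r4_def r1_def p4_def by (simp add: field_simps power2_eq_square)
    then show ?thesis using pos a2 by simp
  qed
  show "p3 * r3 + (1 + n) * (l2 * r2) + w * (l2 * r3 + r2 * p3) = 0"
  proof -
    have "(4 * a * w * l1) * (p3 * r3 + (1 + n) * (l2 * r2) + w * (l2 * r3 + r2 * p3))
       = l2 * (a\<^sup>2 - n\<^sup>2 - 4 * w\<^sup>2)"
      using pos unfolding r3_def r2_def p3_def by (simp add: field_simps power2_eq_square)
    then show ?thesis using pos a2 by simp
  qed
  show "l1 * r3 - r2 * p4 = 1" "l2 * r4 - r1 * p3 = 1" "l1 * p3 = l2 * p4" "r1 * r3 = r2 * r4"
    using pos unfolding p3_def p4_def r1_def r2_def r3_def r4_def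
    by (simp_all add: field_simps)
qed

lemma vector_4_nth [simp]:
  "(vector [x, y, z, t] :: 'a::zero ^ 4) $ 1 = x"
  "(vector [x, y, z, t] :: 'a::zero ^ 4) $ 2 = y"
  "(vector [x, y, z, t] :: 'a::zero ^ 4) $ 3 = z"
  "(vector [x, y, z, t] :: 'a::zero ^ 4) $ 4 = t"
  unfolding vector_def by simp_all

lemma chi_nth:
  "(chi_matrix \<omega> \<nu> *v z) $ 1 = lam1 \<omega> \<nu> * z$1 + - (lam1 \<omega> \<nu> / dpar \<omega> \<nu>) * z$4"
  "(chi_matrix \<omega> \<nu> *v z) $ 2 = lam2 \<omega> \<nu> * z$2 + - (lam2 \<omega> \<nu> / dpar \<omega> \<nu>) * z$3"
  "(chi_matrix \<omega> \<nu> *v z) $ 3 = (dpar \<omega> \<nu> / lam1 \<omega> \<nu> - lam2 \<omega> \<nu> * cpar \<omega> \<nu> * dpar \<omega> \<nu>) * z$2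
     + cpar \<omega> \<nu> * lam2 \<omega> \<nu> * z$3"
  "(chi_matrix \<omega> \<nu> *v z) $ 4 = (dpar \<omega> \<nu> / lam2 \<omega> \<nu> - lam1 \<omega> \<nu> * cpar \<omega> \<nu> * dpar \<omega> \<nu>) * z$1
     + cpar \<omega> \<nu> * lam1 \<omega> \<nu> * z$4"
  by (simp_all add: matrix_vector_mult_def sum_4 chi_matrix_def Let_def)

lemma metap_eq_quadratic_unitary:
  "metap \<omega> \<nu> = quadratic_unitary (dpar \<omega> \<nu> * (1 / (lam1 \<omega> \<nu> * lam2 \<omega> \<nu>) - cpar \<omega> \<nu>))
     (lam1 \<omega> \<nu>) (lam2 \<omega> \<nu>) (1 / dpar \<omega> \<nu>)"
proof (intro ext)
  fix v :: "plane \<Rightarrow> complex" and x :: plane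
  have "fourier_multiplier (\<lambda>\<eta>. exp (2 * \<i> * complex_of_real pi * complex_of_real (fst \<eta> * snd \<eta> / d))) v
     = inverse_fourier (chirp (1 / d) (fourier v))" for d
    by (intro ext) (simp add: fourier_multiplier_def inverse_fourier_def fourier_alt[of "chirp _ _"] chirp_def inner_commute mult_ac)
  then show "metap \<omega> \<nu> v x = quadratic_unitary (dpar \<omega> \<nu> * (1 / (lam1 \<omega> \<nu> * lam2 \<omega> \<nu>) - cpar \<omega> \<nu>))
     (lam1 \<omega> \<nu>) (lam2 \<omega> \<nu>) (1 / dpar \<omega> \<nu>) v x"
    by (simp add: metap_def quadratic_unitary_def chirp_def[of "_ * _"] dilate_def case_prod_unfold Let_def mult_ac)
qed

theorem theorem3p3:
  fixes \<omega> \<nu> \<epsilon> :: real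
  assumes "\<omega> > 0" and "\<nu> \<ge> 0" and "\<epsilon> > 0" and "\<omega>^2 + \<nu>^2 + \<epsilon>^2 = 1"
  shows "symplectic_matrix (chi_matrix \<omega> \<nu>) \<and>
    unitary_on_schwartz (metap \<omega> \<nu>) \<and>
    (\<forall>y1 y2 \<eta>1 \<eta>2. (qform \<omega> \<nu> \<circ> chi \<omega> \<nu>) (vector [y1, y2, \<eta>1, \<eta>2]) =
       (mu1 \<omega> \<nu>)^2 * y1^2 + (mu2 \<omega> \<nu>)^2 * y2^2 + \<eta>1^2 + \<eta>2^2) \<and>
    (\<forall>u\<in>schwartz. weyl (\<lambda>z. of_real ((qform \<omega> \<nu> \<circ> chi \<omega> \<nu>) z)) u =
       adjoint_op (metap \<omega> \<nu>) (weyl (\<lambda>z. of_real (qform \<omega> \<nu> z)) (metap \<omega> \<nu> u)))"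
proof -
  define a n l1 l2 c d where "a = alpha \<omega> \<nu>" and "n = \<nu>\<^sup>2" and "l1 = lam1 \<omega> \<nu>" and "l2 = lam2 \<omega> \<nu>"
    and "c = cpar \<omega> \<nu>" and "d = dpar \<omega> \<nu>"
  note folds = a_def[symmetric] n_def[symmetric] l1_def[symmetric] l2_def[symmetric] c_def[symmetric] d_def[symmetric]
  note pos' = parameters_positive[OF assms, unfolded folds]
  have pos: "\<omega> > 0" "a > 0" "l1 > 0" "l2 > 0" using pos' assms by auto
  have a2: "a\<^sup>2 = n\<^sup>2 + 4 * \<omega>\<^sup>2" unfolding a_def alpha_def n_def by simp
  have "l1\<^sup>2 = (a - 2 * \<omega>\<^sup>2 + n) / (2 * a)"
    using pos(3) unfolding l1_def lam1_def folds by simp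
  then have l1: "2 * a * l1\<^sup>2 = a - 2 * \<omega>\<^sup>2 + n" using pos by simp
  have "l2\<^sup>2 = (a + 2 * \<omega>\<^sup>2 + n) / (2 * a)"
    using pos(4) unfolding l2_def lam2_def folds by simp
  then have l2: "2 * a * l2\<^sup>2 = a + 2 * \<omega>\<^sup>2 + n" using pos by simp
  have mu: "(mu1 \<omega> \<nu>)\<^sup>2 = 1 + \<omega>\<^sup>2 - a" "(mu2 \<omega> \<nu>)\<^sup>2 = 1 + \<omega>\<^sup>2 + a"
    using pos'(2,3) unfolding mu1_def mu2_def folds by simp_all
  define p3 p4 r1 r2 r3 r4 where "p3 = l2 * (a - n) / (2 * \<omega>)" and "p4 = l1 * (a - n) / (2 * \<omega>)"
    and "r1 = - \<omega> / (a * l2)" and "r2 = - \<omega> / (a * l1)"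
    and "r3 = (a + n) / (2 * a * l1)" and "r4 = (a + n) / (2 * a * l2)"
  note co = chi_coefficients[OF pos a2 l1 l2, folded p3_def p4_def r1_def r2_def r3_def r4_def]
  have d: "d = a * l1 * l2 / \<omega>" unfolding d_def dpar_def gam_def folds using pos by simp
  have "a * (l1\<^sup>2 + l2\<^sup>2) = a + n" using l1 l2 by (simp add: algebra_simps)
  then have "l1\<^sup>2 + l2\<^sup>2 = (a + n) / a" using pos by (simp add: field_simps)
  then have c: "c = (a + n) / (2 * a * l1 * l2)" unfolding c_def cpar_def folds by (simp add: mult_ac)
  have entries: "- (l1 / d) = r1" "- (l2 / d) = r2" "d / l1 - l2 * c * d = p3" "d / l2 - l1 * c * d = p4"
    "c * l2 = r3" "c * l1 = r4"
    using pos unfolding c d p3_def p4_def r1_def r2_def r3_def r4_def by (simp_all add: field_simps)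
  note chi_nth' = chi_nth[of \<omega> \<nu>, unfolded folds, unfolded entries]

  have symp: "symplectic_matrix (chi_matrix \<omega> \<nu>)"
    unfolding symplectic_matrix_def symplectic_form_def chi_nth'
  proof (intro allI)
    fix z w :: "real^4"
    have "(p3 * z $ 2 + r3 * z $ 3) * (l1 * w $ 1 + r1 * w $ 4) + (p4 * z $ 1 + r4 * z $ 4) * (l2 * w $ 2 + r2 * w $ 3)
       - ((p3 * w $ 2 + r3 * w $ 3) * (l1 * z $ 1 + r1 * z $ 4) + (p4 * w $ 1 + r4 * w $ 4) * (l2 * z $ 2 + r2 * z $ 3))
      = (l1 * r3 - r2 * p4) * (z $ 3 * w $ 1 - w $ 3 * z $ 1) + (l2 * r4 - r1 * p3) * (z $ 4 * w $ 2 - w $ 4 * z $ 2)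
        + (l1 * p3 - l2 * p4) * (z $ 2 * w $ 1 - w $ 2 * z $ 1) + (r1 * r3 - r2 * r4) * (z $ 3 * w $ 4 - w $ 3 * z $ 4)"
      by (simp add: algebra_simps)
    also have "\<dots> = z $ 3 * w $ 1 + z $ 4 * w $ 2 - (w $ 3 * z $ 1 + w $ 4 * z $ 2)"
      unfolding co(7-10) by simp
    finally show "(p3 * z $ 2 + r3 * z $ 3) * (l1 * w $ 1 + r1 * w $ 4) + (p4 * z $ 1 + r4 * z $ 4) * (l2 * w $ 2 + r2 * w $ 3)
       - ((p3 * w $ 2 + r3 * w $ 3) * (l1 * z $ 1 + r1 * z $ 4) + (p4 * w $ 1 + r4 * w $ 4) * (l2 * z $ 2 + r2 * z $ 3))
      = z $ 3 * w $ 1 + z $ 4 * w $ 2 - (w $ 3 * z $ 1 + w $ 4 * z $ 2)" .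
  qed

  have form: "(qform \<omega> \<nu> \<circ> chi \<omega> \<nu>) (vector [y1, y2, \<eta>1, \<eta>2]) =
       (mu1 \<omega> \<nu>)^2 * y1^2 + (mu2 \<omega> \<nu>)^2 * y2^2 + \<eta>1^2 + \<eta>2^2" for y1 y2 \<eta>1 \<eta>2
  proof -
    have "(qform \<omega> \<nu> \<circ> chi \<omega> \<nu>) (vector [y1, y2, \<eta>1, \<eta>2])
      = (p4\<^sup>2 + (1 - n) * l1\<^sup>2 - 2 * \<omega> * (l1 * p4)) * y1\<^sup>2 + (p3\<^sup>2 + (1 + n) * l2\<^sup>2 + 2 * \<omega> * (l2 * p3)) * y2\<^sup>2
        + (r3\<^sup>2 + (1 + n) * r2\<^sup>2 + 2 * \<omega> * (r2 * r3)) * \<eta>1\<^sup>2 + (r4\<^sup>2 + (1 - n) * r1\<^sup>2 - 2 * \<omega> * (r1 * r4)) * \<eta>2\<^sup>2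
        + 2 * (p4 * r4 + (1 - n) * (l1 * r1) - \<omega> * (l1 * r4 + r1 * p4)) * (y1 * \<eta>2)
        + 2 * (p3 * r3 + (1 + n) * (l2 * r2) + \<omega> * (l2 * r3 + r2 * p3)) * (y2 * \<eta>1)"
      unfolding comp_def qform_def chi_def chi_nth' vector_4_nth folds
      by (simp add: power2_eq_square algebra_simps)
    then show ?thesis unfolding co(1-6) mu by simp
  qed

  define T where "T = quadratic_unitary (d * (1 / (l1 * l2) - c)) l1 l2 (1 / d)"
  have T: "metap \<omega> \<nu> = T" unfolding T_def metap_eq_quadratic_unitary folds ..
  have unitary: "unitary_on_schwartz T"
    unfolding T_def using pos by (intro unitary_quadratic_unitary)
  have rel: "- l1 * (1 / d) = r1" "- l2 * (1 / d) = r2" "d * (1 / (l1 * l2) - c) * l2 = p3"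
    "d * (1 / (l1 * l2) - c) * l1 = p4" "1 / l1 - p3 * (1 / d) = r3" "1 / l2 - p4 * (1 / d) = r4"
    using pos unfolding entries[symmetric] d by (simp_all add: field_simps)
  have weyl_q: "weyl (\<lambda>z. of_real (qform \<omega> \<nu> z)) u = quadratic_operator (1 - n) (1 + n) \<omega> u"
    if "u \<in> schwartz" for u
    unfolding quadratic_operator_def[abs_def]
    by (rule weyl_quadratic[OF that]) (simp add: qform_def phase_point_def folds)
  have weyl_chi: "weyl (\<lambda>z. of_real ((qform \<omega> \<nu> \<circ> chi \<omega> \<nu>) z)) u
      = quadratic_operator ((mu1 \<omega> \<nu>)\<^sup>2) ((mu2 \<omega> \<nu>)\<^sup>2) 0 u" if "u \<in> schwartz" for u
    unfolding quadratic_operator_def[abs_def]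
    by (rule weyl_quadratic[OF that]) (simp only: phase_point_def form, simp)
  have intertwine: "quadratic_operator (1 - n) (1 + n) \<omega> (T u)
      = T (quadratic_operator ((mu1 \<omega> \<nu>)\<^sup>2) ((mu2 \<omega> \<nu>)\<^sup>2) 0 u)" if u: "u \<in> schwartz" for u
  proof (rule quadratic_operator_intertwine[OF _ _ _ _ _ co(1-6)[folded mu] u])
    show "schwartz_linear T" unfolding T_def using pos by (intro linear_quadratic_unitary)
    fix u :: "plane \<Rightarrow> complex" assume u: "u \<in> schwartz"
    show "position e1 (T u) = T (mixed e1 e2 l1 r1 u)"
      unfolding T_def position_quadratic_unitary(1)[OF pos(3,4) u] mixed_def[abs_def] rel ..
    show "position e2 (T u) = T (mixed e2 e1 l2 r2 u)"
      unfolding T_def position_quadratic_unitary(2)[OF pos(3,4) u] mixed_def[abs_def] rel ..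
    show "momentum e1 (T u) = T (mixed e2 e1 p3 r3 u)"
      unfolding T_def momentum_quadratic_unitary(1)[OF pos(3,4) u] mixed_def[abs_def] rel ..
    show "momentum e2 (T u) = T (mixed e1 e2 p4 r4 u)"
      unfolding T_def momentum_quadratic_unitary(2)[OF pos(3,4) u] mixed_def[abs_def] rel ..
  qed
  have "weyl (\<lambda>z. of_real ((qform \<omega> \<nu> \<circ> chi \<omega> \<nu>) z)) u =
       adjoint_op (metap \<omega> \<nu>) (weyl (\<lambda>z. of_real (qform \<omega> \<nu> z)) (metap \<omega> \<nu> u))" if u: "u \<in> schwartz" for u
  proof -
    let ?w = "quadratic_operator ((mu1 \<omega> \<nu>)\<^sup>2) ((mu2 \<omega> \<nu>)\<^sup>2) 0 u"
    have w: "?w \<in> schwartz" using u by (rule schwartz_quadratic_operator)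
    have "weyl (\<lambda>z. of_real (qform \<omega> \<nu> z)) (T u) = T ?w"
      unfolding weyl_q[OF unitary_on_schwartz_maps[OF unitary u]] by (rule intertwine[OF u])
    moreover have "adjoint_op T (T ?w) = ?w"
      using unitary w unfolding unitary_on_schwartz_def by (intro adjoint_op_eqI) auto
    ultimately show ?thesis unfolding T weyl_chi[OF u] by simp
  qed
  with symp form unitary show ?thesis unfolding T by blast
qed

end
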